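(* Let $A,B$ and $S$ be non-empty subsets of a finite Abelian group $G$ with $|A|+|B|=|G|+L_S$. Assume that $0\in A\cap B\cap S$, that $0$ is an $A\wedge^S B$-exception, and that $|A\wedge^S B|=|G|-2|S|$. Then the following hold. (i) Let $S=S_1\cup S_2\cup\cdots\cup S_t$ be the decomposition of $S$ modulo $2\cdot G$. Then $|S_i|=L_S/L(G)$ and $|A\wedge^{S_i}B|=|G|-2|S_i|$ for each $i\in\{1,\ldots,t\}$. Moreover, the set of $A\wedge^S B$-exceptions is partitioned as $G\setminus(A\wedge^S B)=\bigcup_{i=1}^t\big(G\setminus(A\wedge^{S_i}B)\big)$. Without loss of generality, number the parts so that $0\in S_1$. (ii) $S_1$ is a subgroup of $G$. Let $\pi:G\to G/S_1$ be the natural projection, $A'=\pi(A)$ and $B'=\pi(B)$. (iii) There exists $b\in A'\cap B'$ such that $H=\langle 2b\rangle$ is a subgroup of $G/S_1$ of odd order $d$ greater than $1$, and (iv) there exist distinct elements $x_1,\ldots,x_k,x_{k+1},\ldots,x_l,x_{l+1},\ldots,x_m$ of $(G/S_1)\setminus(K(G/S_1)+H)$, where $m=(|G/S_1|/d-L(G/S_1))/2$ and $0\le k\le l\le m$, such that $$(G/S_1)\setminus (K(G/S_1)+H)=\bigcup_{i=1}^m\big((x_i+H)\cup(-x_i+H)\big),$$ $$A'=\big(\{0,b,3b,\ldots,(d-2)b\}+K(G/S_1)\big)\cup Q,\qquad B'=\big(\{0,b,3b,\ldots,(d-2)b\}+K(G/S_1)\big)\cup R,$$ where $Q=\{x_1,\ldots,x_k,\pm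 x_{k+1},\ldots,\pm x_l\}+H$ and $R=\{x_1,\ldots,x_k,\pm x_{l+1},\ldots,\pm x_m\}+H$. Moreover, if (for such $b$ and $x_1,\ldots,x_m$) we suppose that $(d+1)/2>L(G/S_1)$, then: (v) putting $Y=\{y\in G:\ 2y\in S_1\}$, there is a decomposition $Y=\bigcup_{i=1}^r(y_i+S_1)$ of $Y$ into pairwise distinct cosets modulo $S_1$, with $r\ge t$, such that $S_i=y_i+S_1$ for each $i=1,\ldots,t$; in particular $2\cdot S\subset S_1$; (vi) the set of $A\wedge^S B$-exceptions is $\{0,2b^*\}+S$, where $b^*\in\pi^{-1}(b)$; and (vii) $\big(\{0,2b\}+\{\pi(y_1),\pi(y_2),\ldots,\pi(y_t)\}\big)\cap(Q+R)=\emptyset$.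
   Context: Groups are written additively. For subsets $A,B,S$ of a finite Abelian group $G$: $A+B=\{a+b: a\in A, b\in B\}$ and $A\wedge^S B=\{a+b:\ a\in A,\ b\in B,\ a-b\notin S\}$. An $A\wedge^S B$-exception is an element of $(A+B)\setminus (A\wedge^S B)$. For $z\in G$, $L_S(z)=|\{(x,y)\in G\times G:\ x+y=z,\ x-y\in S\}|$, and $L_S=\max_{z\in G}L_S(z)$. For any finite Abelian group $\Gamma$, $K(\Gamma)=\{g\in \Gamma: 2g=0\}$ and $L(\Gamma)=|K(\Gamma)|$. For $T\subset G$, $2\cdot T=\{2t:t\in T\}$; in particular $2\cdot G$ is the subgroup of doubles. The decomposition of $S$ modulo $2\cdot G$ is the partition of $S$ into its non-empty intersections with the cosets of $2\cdot G$. The set $\{0,b,3b,\ldots,(d-2)b\}$ consists of $0$ and the odd multiples $jb$ with $1\le j\le d-2$, $j$ odd. *)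

theory Defs
  imports Complex_Main "HOL-Algebra.Coset" "HOL-Algebra.Generated_Groups" "HOL-Library.Disjoint_Sets"
begin

text \<open>
  Abelian groups are rendered as the multiplicatively written \<^locale>\<open>comm_group\<close>: a sum \<open>a + b\<close>
  becomes \<open>a \<otimes> b\<close>, a difference \<open>a - b\<close> becomes \<open>a \<otimes> inv b\<close>, the multiple \<open>j b\<close> becomes
  \<open>b [^] j\<close>, the sumset \<open>A + B\<close> becomes \<open>A <#> B\<close>, and \<open>G / N\<close> is \<open>G Mod N\<close>.
\<close>

definition restricted_sumset :: "('a, 'b) monoid_scheme \<Rightarrow> 'a set \<Rightarrow> 'a set \<Rightarrow> 'a set \<Rightarrow> 'a set"
  where "restricted_sumset G S A B =
    {a \<otimes>\<^bsub>G\<^esub> b | a b. a \<in> A \<and> b \<in> B \<and> a \<otimes>\<^bsub>G\<^esub> inv\<^bsub>G\<^esub> b \<notin> S}"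

definition exceptions :: "('a, 'b) monoid_scheme \<Rightarrow> 'a set \<Rightarrow> 'a set \<Rightarrow> 'a set \<Rightarrow> 'a set"
  where "exceptions G S A B = (A <#>\<^bsub>G\<^esub> B) - restricted_sumset G S A B"

definition L_at :: "('a, 'b) monoid_scheme \<Rightarrow> 'a set \<Rightarrow> 'a \<Rightarrow> nat"
  where "L_at G S z = card {(x, y). x \<in> carrier G \<and> y \<in> carrier G \<and>
    x \<otimes>\<^bsub>G\<^esub> y = z \<and> x \<otimes>\<^bsub>G\<^esub> inv\<^bsub>G\<^esub> y \<in> S}"

definition L_max :: "('a, 'b) monoid_scheme \<Rightarrow> 'a set \<Rightarrow> nat"
  where "L_max G S = Max (L_at G S ` carrier G)"

definition K_grp :: "('a, 'b) monoid_scheme \<Rightarrow> 'a set"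
  where "K_grp G = {g \<in> carrier G. g \<otimes>\<^bsub>G\<^esub> g = \<one>\<^bsub>G\<^esub>}"

definition L_grp :: "('a, 'b) monoid_scheme \<Rightarrow> nat"
  where "L_grp G = card (K_grp G)"

definition doubles :: "('a, 'b) monoid_scheme \<Rightarrow> 'a set \<Rightarrow> 'a set"
  where "doubles G T = (\<lambda>t. t \<otimes>\<^bsub>G\<^esub> t) ` T"

definition decomposition_mod_doubles :: "('a, 'b) monoid_scheme \<Rightarrow> 'a set \<Rightarrow> 'a set set"
  where "decomposition_mod_doubles G S =
    {S \<inter> C | C. C \<in> rcosets\<^bsub>G\<^esub> (doubles G (carrier G)) \<and> S \<inter> C \<noteq> {}}"

text \<open>The set \<open>{0, b, 3b, \<dots>, (d - 2)b}\<close>.\<close>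

definition zero_odd_multiples :: "('a, 'b) monoid_scheme \<Rightarrow> 'a \<Rightarrow> nat \<Rightarrow> 'a set"
  where "zero_odd_multiples G b d =
    insert \<one>\<^bsub>G\<^esub> {b [^]\<^bsub>G\<^esub> j | j :: nat. odd j \<and> 1 \<le> j \<and> j + 2 \<le> d}"

text \<open>
  The sets \<open>{x\<^sub>1, \<dots>, x\<^sub>k, \<plusminus>x\<^sub>p\<^sub>+\<^sub>1, \<dots>, \<plusminus>x\<^sub>q} + H\<close>; \<open>Q\<close> is the instance \<open>(p, q) = (k, l)\<close>
  and \<open>R\<close> is the instance \<open>(p, q) = (l, m)\<close>.
\<close>

definition signed_part ::
    "('a, 'b) monoid_scheme \<Rightarrow> 'a set \<Rightarrow> (nat \<Rightarrow> 'a) \<Rightarrow> nat \<Rightarrow> nat \<Rightarrow> nat \<Rightarrow> 'a set"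
  where "signed_part G H x k p q =
    (x ` {1..k} \<union> x ` {p+1..q} \<union> (\<lambda>i. inv\<^bsub>G\<^esub> (x i)) ` {p+1..q}) <#>\<^bsub>G\<^esub> H"

text \<open>
  The structural description of a pair \<open>(A, B)\<close> of subsets of \<open>G\<close> (to be used for \<open>G / S\<^sub>1\<close> and the
  projected sets) by an element \<open>b\<close> and representatives \<open>x\<^sub>1, \<dots>, x\<^sub>m\<close>, with \<open>H = \<langle>2b\<rangle>\<close> and \<open>d = |H|\<close>.
\<close>

definition pair_structure ::
    "('a, 'b) monoid_scheme \<Rightarrow> 'a set \<Rightarrow> 'a set \<Rightarrow> 'a \<Rightarrow> (nat \<Rightarrow> 'a) \<Rightarrow> nat \<Rightarrow> nat \<Rightarrow> nat \<Rightarrow> bool"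
  where "pair_structure G A B b x k l m \<longleftrightarrow>
    (let H = generate G {b \<otimes>\<^bsub>G\<^esub> b}; d = card H; U = carrier G - (K_grp G <#>\<^bsub>G\<^esub> H) in
      b \<in> A \<inter> B \<and> subgroup H G \<and> odd d \<and> d > 1 \<and>
      real m = (real (order G) / real d - real (L_grp G)) / 2 \<and> k \<le> l \<and> l \<le> m \<and>
      inj_on x {1..m} \<and> x ` {1..m} \<subseteq> U \<and>
      U = (\<Union>i\<in>{1..m}. (H #>\<^bsub>G\<^esub> x i) \<union> (H #>\<^bsub>G\<^esub> inv\<^bsub>G\<^esub> (x i))) \<and>
      A = (zero_odd_multiples G b d <#>\<^bsub>G\<^esub> K_grp G) \<union> signed_part G H x k k l \<and>
      B = (zero_odd_multiples G b d <#>\<^bsub>G\<^esub> K_grp G) \<union> signed_part G H x k l m)"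

end

theory Submission
  imports Defs "HOL-Algebra.Multiplicative_Group"
begin

text \<open>
  In additive notation: if \<open>z\<close> is not in the restricted sumset for \<open>T\<close>, where
  \<open>|A| + |B| = |G| + L(G) |T|\<close>, then \<open>A\<close> meets \<open>z - B\<close> exactly in \<open>D\<^sub>z = {x. 2x \<in> z + T}\<close>, and
  \<open>A \<union> (z - B) = G\<close>. Fixing one such \<open>z\<close>, the others are the \<open>z + 2u\<close> for which the indicator
  functions of \<open>A\<close> and \<open>D = D\<^sub>z\<close> satisfy \<open>A(w + 2u) - A(w) = D(w + u) - D(w)\<close> for all \<open>w\<close>.

  Choose \<open>x \<in> D\<close> and such a \<open>u\<close> with \<open>x + u \<notin> D\<close>, and put \<open>p = x + 2u\<close>. Every \<open>v\<close> of this kind has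
  \<open>x - v \<in> D\<close> or \<open>p - 2v \<in> D\<close>; modulo the common periods of the configuration \<open>v \<mapsto> 2v\<close> is injective, so
  there are at most \<open>2 |D|\<close> such \<open>v\<close>. In the extremal case all differences of elements of \<open>D\<close> are of
  this kind, whence \<open>D\<close> is a coset of a subgroup. Summing the bound over the parts of \<open>S\<close> forces
  equality for each of them.

  In \<open>G / S\<^sub>1\<close> the set \<open>D\<close> becomes \<open>K\<close>, and the functional equation for \<open>u = b\<close> says that \<open>A\<close> is
  \<open>\<langle>2b\<rangle>\<close>-periodic outside \<open>K + \<langle>2b\<rangle>\<close>, and that on each coset \<open>\<kappa> + \<langle>2b\<rangle>\<close>, \<open>\<kappa> \<in> K\<close>, it is an
  arithmetic progression of length \<open>(d + 1) / 2\<close>. For the other parts, \<open>A - D\<^sub>z\<close> is a translate of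
  \<open>A - K\<close>, and such a progression leaves only two possibilities for the translation.
\<close>

section \<open>Double shifts\<close>

text \<open>The differences are taken in the integers because a set can lose a point as well as gain
  one. Each later use is then a case split on four memberships.\<close>

definition shift_set :: "('a, 'b) monoid_scheme \<Rightarrow> 'a set \<Rightarrow> 'a set \<Rightarrow> 'a set"
  where "shift_set G A D = {u \<in> carrier G. \<forall>w\<in>carrier G.
    of_bool (w \<otimes>\<^bsub>G\<^esub> (u \<otimes>\<^bsub>G\<^esub> u) \<in> A) - of_bool (w \<in> A) =
    (of_bool (w \<otimes>\<^bsub>G\<^esub> u \<in> D) - of_bool (w \<in> D) :: int)}"

context comm_group
begin

text \<open>Together with \<open>m_ac\<close> and \<open>inv_mult\<close> these rules normalise
  products: after sorting, an element and its inverse may be separated by one or, in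
  \<open>inv_cancel2\<close>, two factors.\<close>

lemma inv_cancel:
  assumes "x \<in> carrier G" "y \<in> carrier G"
  shows "x \<otimes> (inv x \<otimes> y) = y" "inv x \<otimes> (x \<otimes> y) = y"
    "x \<otimes> (y \<otimes> inv x) = y" "inv x \<otimes> (y \<otimes> x) = y"
    "z \<in> carrier G \<Longrightarrow> x \<otimes> (y \<otimes> (inv x \<otimes> z)) = y \<otimes> z"
    "z \<in> carrier G \<Longrightarrow> inv x \<otimes> (y \<otimes> (x \<otimes> z)) = y \<otimes> z"
proof -
  have *: "x \<otimes> (inv x \<otimes> y) = y" "inv x \<otimes> (x \<otimes> y) = y" if "y \<in> carrier G" for y
    using assms that by (simp_all add: m_assoc[symmetric])
  show "x \<otimes> (inv x \<otimes> y) = y" "inv x \<otimes> (x \<otimes> y) = y"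
    using *[OF assms(2)] .
  show "x \<otimes> (y \<otimes> inv x) = y" "inv x \<otimes> (y \<otimes> x) = y"
    using *[OF assms(2)] assms by (simp_all add: m_comm)
  show "x \<otimes> (y \<otimes> (inv x \<otimes> z)) = y \<otimes> z" "inv x \<otimes> (y \<otimes> (x \<otimes> z)) = y \<otimes> z"
    if "z \<in> carrier G"
    using *[of "y \<otimes> z"] assms that m_lcomm[of y "inv x" z] m_lcomm[of y x z] by simp_all
qed

lemma inv_cancel2:
  assumes "x \<in> carrier G" "y \<in> carrier G" "z \<in> carrier G"
  shows "x \<otimes> (y \<otimes> (z \<otimes> inv x)) = y \<otimes> z" "inv x \<otimes> (y \<otimes> (z \<otimes> x)) = y \<otimes> z"
    "w \<in> carrier G \<Longrightarrow> x \<otimes> (y \<otimes> (z \<otimes> (inv x \<otimes> w))) = y \<otimes> (z \<otimes> w)"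
    "w \<in> carrier G \<Longrightarrow> inv x \<otimes> (y \<otimes> (z \<otimes> (x \<otimes> w))) = y \<otimes> (z \<otimes> w)"
  using inv_cancel(3-6)[of x "y \<otimes> z"] assms by (simp_all add: m_assoc)

lemma shift_setD:
  assumes "u \<in> shift_set G A D" "w \<in> carrier G"
  shows "of_bool (w \<otimes> (u \<otimes> u) \<in> A) - of_bool (w \<in> A) =
    (of_bool (w \<otimes> u \<in> D) - of_bool (w \<in> D) :: int)"
  using assms unfolding shift_set_def by blast

lemma shift_set_carrier: "shift_set G A D \<subseteq> carrier G"
  unfolding shift_set_def by blast

section \<open>Common periods of a configuration\<close>

text \<open>For such q the identity of \<open>shift_set\<close> degenerates to \<open>A\<close>
  having period 2q; \<open>A\<close> is not asked to have period q itself.\<close>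

definition shift_periods :: "'a set \<Rightarrow> 'a set \<Rightarrow> 'a set"
  where "shift_periods A D = {q \<in> shift_set G A D. \<forall>w\<in>carrier G. w \<otimes> q \<in> D \<longleftrightarrow> w \<in> D}"

lemma shift_periodsD:
  assumes "q \<in> shift_periods A D"
  shows "q \<in> carrier G" "w \<in> carrier G \<Longrightarrow> w \<otimes> q \<in> D \<longleftrightarrow> w \<in> D"
    "w \<in> carrier G \<Longrightarrow> w \<otimes> (q \<otimes> q) \<in> A \<longleftrightarrow> w \<in> A"
proof -
  show "q \<in> carrier G" and *: "w \<in> carrier G \<Longrightarrow> w \<otimes> q \<in> D \<longleftrightarrow> w \<in> D"
    using assms shift_set_carrier unfolding shift_periods_def by blast+
  show "w \<in> carrier G \<Longrightarrow> w \<otimes> (q \<otimes> q) \<in> A \<longleftrightarrow> w \<in> A"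
    using assms shift_setD[of q A D w] * unfolding shift_periods_def
    by (auto simp: of_bool_def split: if_splits)
qed

lemma shift_periodsI:
  assumes "q \<in> carrier G" "\<And>w. w \<in> carrier G \<Longrightarrow> w \<otimes> q \<in> D \<longleftrightarrow> w \<in> D"
    "\<And>w. w \<in> carrier G \<Longrightarrow> w \<otimes> (q \<otimes> q) \<in> A \<longleftrightarrow> w \<in> A"
  shows "q \<in> shift_periods A D"
  using assms unfolding shift_periods_def shift_set_def by simp

lemma subgroup_shift_periods: "subgroup (shift_periods A D) G"
proof (rule subgroupI)
  show "shift_periods A D \<subseteq> carrier G"
    using shift_periodsD(1) by blast
  show "shift_periods A D \<noteq> {}"
    using shift_periodsI[of \<one> D A] by auto
  fix q assume q: "q \<in> shift_periods A D"
  note qc = shift_periodsD(1)[OF q]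
  show "inv q \<in> shift_periods A D"
  proof (rule shift_periodsI)
    fix w assume w: "w \<in> carrier G"
    show "w \<otimes> inv q \<in> D \<longleftrightarrow> w \<in> D"
      using shift_periodsD(2)[OF q, of "w \<otimes> inv q"] w qc by (simp add: m_assoc)
    have "w \<otimes> (inv q \<otimes> inv q) \<otimes> (q \<otimes> q) = w"
      using w qc by (simp add: inv_mult_group[symmetric] m_assoc)
    thus "w \<otimes> (inv q \<otimes> inv q) \<in> A \<longleftrightarrow> w \<in> A"
      using shift_periodsD(3)[OF q, of "w \<otimes> (inv q \<otimes> inv q)"] w qc by simp
  qed (use qc in auto)
  fix r assume r: "r \<in> shift_periods A D"
  note rc = shift_periodsD(1)[OF r]
  show "q \<otimes> r \<in> shift_periods A D"
  proof (rule shift_periodsI)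
    fix w assume w: "w \<in> carrier G"
    show "w \<otimes> (q \<otimes> r) \<in> D \<longleftrightarrow> w \<in> D"
      using shift_periodsD(2)[OF q, of "w"] shift_periodsD(2)[OF r, of "w \<otimes> q"] w qc rc
      by (simp add: m_assoc)
    show "w \<otimes> (q \<otimes> r \<otimes> (q \<otimes> r)) \<in> A \<longleftrightarrow> w \<in> A"
      using shift_periodsD(3)[OF q, of "w"] shift_periodsD(3)[OF r, of "w \<otimes> (q \<otimes> q)"] w qc rc
      by (simp add: m_ac)
  qed (use qc rc in auto)
qed

text \<open>Moving by q changes neither side of the identity, so \<open>shift_set\<close> is a union
  of cosets of the group of periods.\<close>

lemma shift_set_mult_period:
  assumes u: "u \<in> shift_set G A D" and q: "q \<in> shift_periods A D"
  shows "u \<otimes> q \<in> shift_set G A D"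
proof -
  have c: "u \<in> carrier G" "q \<in> carrier G"
    using u shift_set_carrier shift_periodsD(1)[OF q] by auto
  have "of_bool (w \<otimes> (u \<otimes> q \<otimes> (u \<otimes> q)) \<in> A) - of_bool (w \<in> A) =
     (of_bool (w \<otimes> (u \<otimes> q) \<in> D) - of_bool (w \<in> D) :: int)" if w: "w \<in> carrier G" for w
  proof -
    have "w \<otimes> (u \<otimes> q \<otimes> (u \<otimes> q)) = w \<otimes> (u \<otimes> u) \<otimes> (q \<otimes> q)"
      "w \<otimes> (u \<otimes> q) = w \<otimes> u \<otimes> q"
      using c w by (simp_all add: m_ac)
    thus ?thesis
      using shift_periodsD(2)[OF q, of "w \<otimes> u"] shift_periodsD(3)[OF q, of "w \<otimes> (u \<otimes> u)"]
        shift_setD[OF u w] c w by simp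
  qed
  thus ?thesis using c by (simp add: shift_set_def)
qed

text \<open>Doubling is injective modulo the periods: writing \<open>q = u - v\<close>, two steps of \<open>2q\<close> leave \<open>A\<close> fixed,
  while each of them changes it by the same difference of translates of \<open>D\<close>.\<close>

lemma shift_quotient_period:
  assumes u: "u \<in> shift_set G A D" and v: "v \<in> shift_set G A D"
    and uv: "u \<otimes> u \<otimes> inv (v \<otimes> v) \<in> shift_periods A D"
  shows "u \<otimes> inv v \<in> shift_periods A D"
proof -
  define q where "q = u \<otimes> inv v"
  have c: "u \<in> carrier G" "v \<in> carrier G"
    using u v shift_set_carrier by auto
  hence qc: "q \<in> carrier G" by (simp add: q_def)
  have uq: "u = q \<otimes> v" using c by (simp add: q_def m_assoc)
  have "u \<otimes> u \<otimes> inv (v \<otimes> v) = q \<otimes> q"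
    using c by (simp add: q_def inv_mult_group m_ac)
  hence qq: "q \<otimes> q \<in> shift_periods A D" using uv by simp
  \<comment> \<open>Subtracting the identities for u and v at the same point cancels A(w) and
    D(w).\<close>
  have eq: "of_bool (w \<otimes> v \<otimes> v \<otimes> (q \<otimes> q) \<in> A) - of_bool (w \<otimes> v \<otimes> v \<in> A) =
     (of_bool (w \<otimes> v \<otimes> q \<in> D) - of_bool (w \<otimes> v \<in> D) :: int)" if w: "w \<in> carrier G" for w
  proof -
    have "w \<otimes> (u \<otimes> u) = w \<otimes> v \<otimes> v \<otimes> (q \<otimes> q)" "w \<otimes> u = w \<otimes> v \<otimes> q"
      "w \<otimes> (v \<otimes> v) = w \<otimes> v \<otimes> v"
      using c qc w by (simp_all add: uq m_ac)
    thus ?thesis using shift_setD[OF u w] shift_setD[OF v w] by simp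
  qed
  have D: "w \<otimes> q \<in> D \<longleftrightarrow> w \<in> D" if w: "w \<in> carrier G" for w
  proof -
    \<comment> \<open>At w - v and at w - v + 2q, \<open>eq\<close> gives two consecutive steps of
      2q starting from w + v. Both have right side D(w + q) - D(w), since 2q is a period of
      \<open>D\<close>, and together they add up to zero, since 4q is a period of
      \<open>A\<close>.\<close>
    define w1 where "w1 = w \<otimes> inv v"
    define w2 where "w2 = w \<otimes> inv v \<otimes> (q \<otimes> q)"
    have w12: "w1 \<in> carrier G" "w2 \<in> carrier G" using w c qc by (auto simp: w1_def w2_def)
    have e1: "w1 \<otimes> v = w" "w2 \<otimes> v = w \<otimes> (q \<otimes> q)" "w1 \<otimes> v \<otimes> v = w \<otimes> v"
      "w2 \<otimes> v \<otimes> v = w \<otimes> v \<otimes> (q \<otimes> q)"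
    proof -
      show "w1 \<otimes> v = w" using w c by (simp add: w1_def m_assoc)
      thus "w1 \<otimes> v \<otimes> v = w \<otimes> v" by simp
      show 1: "w2 \<otimes> v = w \<otimes> (q \<otimes> q)"
        using w c qc unfolding w2_def by (simp add: m_ac inv_cancel inv_cancel2)
      show "w2 \<otimes> v \<otimes> v = w \<otimes> v \<otimes> (q \<otimes> q)" unfolding 1 using w c qc by (simp add: m_ac)
    qed
    have e2: "w \<otimes> (q \<otimes> q) \<otimes> q = w \<otimes> q \<otimes> (q \<otimes> q)"
      "w \<otimes> (q \<otimes> q) \<otimes> v = w \<otimes> v \<otimes> (q \<otimes> q)" using c w qc by (simp_all add: m_ac)
    have A4: "w \<otimes> v \<otimes> (q \<otimes> q) \<otimes> (q \<otimes> q) \<in> A \<longleftrightarrow> w \<otimes> v \<in> A"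
      using shift_periodsD(3)[OF qq, of "w \<otimes> v"] w c qc by (simp add: m_assoc)
    have D2: "w \<otimes> (q \<otimes> q) \<in> D \<longleftrightarrow> w \<in> D" "w \<otimes> q \<otimes> (q \<otimes> q) \<in> D \<longleftrightarrow> w \<otimes> q \<in> D"
      using shift_periodsD(2)[OF qq] w qc by auto
    show ?thesis
      using eq[OF w12(1)] eq[OF w12(2)] A4 D2 unfolding e1 e2
      by (auto simp: of_bool_def split: if_splits)
  qed
  have "w \<otimes> (q \<otimes> q) \<in> A \<longleftrightarrow> w \<in> A" if w: "w \<in> carrier G" for w
  proof -
    define w1 where "w1 = w \<otimes> inv v \<otimes> inv v"
    have "w1 \<in> carrier G" "w1 \<otimes> v \<otimes> v = w" using w c by (auto simp: w1_def m_assoc)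
    thus ?thesis using eq[of w1] D[of "w1 \<otimes> v"] c by (auto simp: of_bool_def split: if_splits)
  qed
  thus ?thesis using D qc unfolding q_def[symmetric] by (intro shift_periodsI)
qed

section \<open>Counting double shifts\<close>

text \<open>Every v counted here sends p = x + 2u to a point p - 2v of \<open>D\<close>. As v -> 2v
  is injective only modulo periods, the map into \<open>D\<close> is corrected by the displacement
  of v from a chosen representative of its coset; this displacement is a period, so the image stays
  in \<open>D\<close>.\<close>

lemma card_nonreturning_shifts:
  assumes fin: "finite (carrier G)" and AG: "A \<subseteq> carrier G" and DA: "D \<subseteq> A"
    and x: "x \<in> D" and u: "u \<in> shift_set G A D" and xu: "x \<otimes> u \<notin> D"
  shows "card {v \<in> shift_set G A D. x \<otimes> inv v \<notin> D} \<le> card D"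
proof -
  define V where "V = {v \<in> shift_set G A D. x \<otimes> inv v \<notin> D}"
  define P where "P = shift_periods A D"
  define p where "p = x \<otimes> (u \<otimes> u)"
  define \<rho> where "\<rho> v = (SOME r. r \<in> P #> v)" for v
  interpret P: subgroup P G unfolding P_def by (rule subgroup_shift_periods)
  have xc: "x \<in> carrier G" and uc: "u \<in> carrier G"
    using x u DA AG shift_set_carrier by blast+
  have pc: "p \<in> carrier G" using xc uc by (simp add: p_def)
  have Vc: "v \<in> carrier G" if "v \<in> V" for v
    using that shift_set_carrier unfolding V_def by blast
  \<comment> \<open>At x the right side of the identity for u is -1, so \<open>A\<close> loses a
    point between x and p.\<close>
  have pA: "p \<notin> A"
    using shift_setD[OF u xc] x xu DA unfolding p_def by (auto simp: of_bool_def split: if_splits)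
  \<comment> \<open>Three uses of the identity: v at y = x - 2v gives A(y) - D(y) = 1; u at y then
    keeps y + 2u = p - 2v in \<open>A\<close>; finally v at p - 2v loses a point of
    \<open>A\<close>, which is possible only if p - 2v lies in \<open>D\<close>.\<close>
  have pV: "p \<otimes> inv (v \<otimes> v) \<in> D" if v: "v \<in> V" for v
  proof -
    have vE: "v \<in> shift_set G A D" "x \<otimes> inv v \<notin> D" using v by (auto simp: V_def)
    define y where "y = x \<otimes> inv (v \<otimes> v)"
    have yc: "y \<in> carrier G" using xc Vc[OF v] by (simp add: y_def)
    have e: "y \<otimes> (v \<otimes> v) = x" "y \<otimes> v = x \<otimes> inv v"
      "p \<otimes> inv (v \<otimes> v) \<otimes> (v \<otimes> v) = p" "y \<otimes> (u \<otimes> u) = p \<otimes> inv (v \<otimes> v)"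
      using xc pc uc Vc[OF v] by (simp_all add: p_def y_def inv_mult m_ac inv_cancel inv_cancel2)
    have "y \<in> A" "y \<notin> D"
      using shift_setD[OF vE(1) yc] vE(2) x DA unfolding e
      by (auto simp: of_bool_def split: if_splits)
    hence 1: "p \<otimes> inv (v \<otimes> v) \<in> A"
      using shift_setD[OF u yc] unfolding e by (auto simp: of_bool_def split: if_splits)
    have "p \<otimes> inv (v \<otimes> v) \<in> carrier G" using pc Vc[OF v] by simp
    from shift_setD[OF vE(1) this] 1 pA show ?thesis
      unfolding e by (auto simp: of_bool_def split: if_splits)
  qed
  have \<rho>: "\<rho> v \<in> V" "v \<otimes> inv (\<rho> v) \<in> P" if v: "v \<in> V" for v
  proof -
    have "\<rho> v \<in> P #> v" unfolding \<rho>_def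
      by (rule someI[of _ v]) (rule rcos_self[OF Vc[OF v] P.subgroup_axioms])
    then obtain q where q: "q \<in> P" "\<rho> v = q \<otimes> v" by (auto simp: r_coset_def)
    note qc = P.mem_carrier[OF q(1)] and vc = Vc[OF v]
    have "\<rho> v \<in> shift_set G A D"
      using shift_set_mult_period[of v A D q] q v vc qc by (simp add: V_def P_def m_comm)
    moreover have "x \<otimes> inv (\<rho> v) \<notin> D"
    proof -
      have "x \<otimes> inv (\<rho> v) \<otimes> q = x \<otimes> inv v"
        using xc vc qc by (simp add: q inv_mult m_ac inv_cancel inv_cancel2)
      thus ?thesis using shift_periodsD(2)[of q A D "x \<otimes> inv (\<rho> v)"] q v vc qc xc
        by (auto simp: V_def P_def)
    qed
    ultimately show "\<rho> v \<in> V" by (simp add: V_def)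
    have "v \<otimes> inv (\<rho> v) = inv q" using vc qc by (simp add: q inv_mult m_ac inv_cancel inv_cancel2)
    thus "v \<otimes> inv (\<rho> v) \<in> P" using q by simp
  qed
  \<comment> \<open>The first factor depends only on the coset of v modulo periods; the second
    separates the members of that coset.\<close>
  define f where "f v = p \<otimes> inv (\<rho> v \<otimes> \<rho> v) \<otimes> (v \<otimes> inv (\<rho> v))" for v
  have "f ` V \<subseteq> D"
  proof
    fix y assume "y \<in> f ` V"
    then obtain v where v: "v \<in> V" "y = f v" by blast
    have "p \<otimes> inv (\<rho> v \<otimes> \<rho> v) \<in> carrier G" using pc Vc \<rho>(1)[OF v(1)] by simp
    with shift_periodsD(2)[OF \<rho>(2)[OF v(1), unfolded P_def] this]
    show "y \<in> D" using pV[OF \<rho>(1)[OF v(1)]] by (simp add: v f_def)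
  qed
  moreover have "inj_on f V"
  proof (rule inj_onI)
    fix v w assume v: "v \<in> V" and w: "w \<in> V" and eq: "f v = f w"
    let ?a = "\<rho> v" and ?b = "\<rho> w"
    have c: "v \<in> carrier G" "w \<in> carrier G" "?a \<in> carrier G" "?b \<in> carrier G"
      using v w Vc \<rho>(1) by auto
    define q where "q = v \<otimes> inv ?a"
    define r where "r = w \<otimes> inv ?b"
    have qr: "q \<in> P" "r \<in> P" using \<rho>(2) v w by (auto simp: q_def r_def)
    note qrc = P.mem_carrier[OF qr(1)] P.mem_carrier[OF qr(2)]
    have e: "p \<otimes> (inv (?a \<otimes> ?a) \<otimes> q) = p \<otimes> (inv (?b \<otimes> ?b) \<otimes> r)"
      using eq c pc qrc by (simp add: f_def q_def[symmetric] r_def[symmetric] m_assoc)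
    hence e': "inv (?a \<otimes> ?a) \<otimes> q = inv (?b \<otimes> ?b) \<otimes> r"
      using c pc qrc by simp
    have "?a \<otimes> ?a \<otimes> inv (?b \<otimes> ?b) = ?a \<otimes> ?a \<otimes> (inv (?b \<otimes> ?b) \<otimes> r) \<otimes> inv r"
      using c qrc by (simp add: m_assoc)
    also have "\<dots> = q \<otimes> inv r"
      unfolding e'[symmetric] using c qrc by (simp add: inv_mult m_ac inv_cancel inv_cancel2)
    \<comment> \<open>The difference of 2\<rho>(v) and 2\<rho>(w) is a period, and
      \<open>shift_quotient_period\<close> halves it. So v and w lie in one coset and share their
      representative.\<close>
    finally have "?a \<otimes> ?a \<otimes> inv (?b \<otimes> ?b) \<in> P" using qr by simp
    hence "?a \<otimes> inv ?b \<in> P"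
      using shift_quotient_period[of ?a A D ?b] \<rho>(1) v w by (auto simp: V_def P_def)
    hence "q \<otimes> (?a \<otimes> inv ?b) \<otimes> inv r \<in> P" using qr by simp
    moreover have "q \<otimes> (?a \<otimes> inv ?b) \<otimes> inv r = v \<otimes> inv w"
      using c by (simp add: q_def r_def inv_mult m_ac inv_cancel inv_cancel2)
    ultimately have "P #> v = P #> w"
      using c P.subgroup_axioms P.rcos_module[OF is_group, of w v] by (metis \<open>q \<otimes> (?a \<otimes> inv ?b) \<otimes> inv r \<in> P\<close> repr_independence)
    hence ab: "?a = ?b" by (simp add: \<rho>_def)
    with e' have "q = r" using c qrc by simp
    thus "v = w" using ab c unfolding q_def r_def by simp
  qed
  moreover have "finite D" using fin AG DA by (meson finite_subset)
  ultimately show ?thesis unfolding V_def by (metis card_inj_on_le)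
qed

text \<open>The map v -> x - v embeds the returning shifts into \<open>D\<close>. If the numbers
  agree it is onto, so every difference x - d is a shift.\<close>

lemma shift_set_returning:
  fixes A D :: "'a set"
  assumes fin: "finite D" and DG: "D \<subseteq> carrier G" and x: "x \<in> carrier G"
  defines "R \<equiv> {v \<in> shift_set G A D. x \<otimes> inv v \<in> D}"
  shows "card R \<le> card D" "card R = card D \<Longrightarrow> d \<in> D \<Longrightarrow> x \<otimes> inv d \<in> shift_set G A D"
proof -
  have Rc: "R \<subseteq> carrier G" using shift_set_carrier by (auto simp: R_def)
  have inj: "inj_on (\<lambda>v. x \<otimes> inv v) R"
  proof (rule inj_onI)
    fix v w assume "v \<in> R" "w \<in> R" "x \<otimes> inv v = x \<otimes> inv w"
    moreover from this have "v \<in> carrier G" "w \<in> carrier G" using Rc by auto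
    ultimately show "v = w" using x by (metis inv_closed inv_inv Units_eq Units_l_cancel)
  qed
  have sub: "(\<lambda>v. x \<otimes> inv v) ` R \<subseteq> D" by (auto simp: R_def)
  show "card R \<le> card D" using card_inj_on_le[OF inj sub fin] .
  assume "card R = card D" and d: "d \<in> D"
  hence "(\<lambda>v. x \<otimes> inv v) ` R = D"
    using card_subset_eq[OF fin sub] card_image[OF inj] by simp
  then obtain v where v: "v \<in> R" "d = x \<otimes> inv v" using d by blast
  hence "x \<otimes> inv d = v" using x Rc by (auto simp: inv_mult m_ac inv_cancel inv_cancel2)
  thus "x \<otimes> inv d \<in> shift_set G A D" using v by (simp add: R_def)
qed

text \<open>Pigeonhole; this supplies the u required by
  \<open>card_nonreturning_shifts\<close>.\<close>

lemma shift_set_leaves: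
  assumes fin: "finite D" and DG: "D \<subseteq> carrier G" and x: "x \<in> D"
    and card: "card D < card (shift_set G A D)"
  obtains u where "u \<in> shift_set G A D" "x \<otimes> u \<notin> D"
proof -
  have "inj_on (\<lambda>u. x \<otimes> u) (shift_set G A D)"
    using x DG shift_set_carrier[of A D] by (auto intro!: inj_onI simp: subset_iff)
  hence "\<not> (\<lambda>u. x \<otimes> u) ` shift_set G A D \<subseteq> D"
    using card_inj_on_le[of "\<lambda>u. x \<otimes> u" "shift_set G A D" D] fin card by linarith
  thus ?thesis using that by blast
qed

lemma card_shift_set_split:
  assumes "finite (carrier G)"
  shows "card (shift_set G A D) = card {v \<in> shift_set G A D. x \<otimes> inv v \<in> D} +
    card {v \<in> shift_set G A D. x \<otimes> inv v \<notin> D}"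
proof -
  have "finite (shift_set G A D)" using assms shift_set_carrier finite_subset by blast
  thus ?thesis
    by (subst card_Un_disjoint[symmetric]) (auto intro!: arg_cong[where f = card])
qed

text \<open>Split the shifts according to whether they return a fixed x to \<open>D\<close>: each
  class has at most |D| members.\<close>

lemma card_shift_set_le:
  assumes fin: "finite (carrier G)" and AG: "A \<subseteq> carrier G" and DA: "D \<subseteq> A" and "D \<noteq> {}"
  shows "card (shift_set G A D) \<le> 2 * card D"
proof (rule ccontr)
  assume neg: "\<not> ?thesis"
  obtain x where x: "x \<in> D" using assms by blast
  have D: "finite D" "D \<subseteq> carrier G" using DA AG finite_subset[OF _ fin] by auto
  obtain u where "u \<in> shift_set G A D" "x \<otimes> u \<notin> D"
    using shift_set_leaves[OF D x] neg by (metis linorder_not_le mult_2 trans_le_add1)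
  from card_nonreturning_shifts[OF fin AG DA x this] shift_set_returning(1)[OF D, of x A]
  show False using neg card_shift_set_split[OF fin, of A D x] x D by force
qed

text \<open>Equality leaves no slack in either class, so for x and d in \<open>D\<close> every
  difference x - d is a shift. Since 0 is in \<open>D\<close>, both d and -d are shifts, and such
  opposite shifts turn out to be periods of \<open>D\<close>.\<close>

lemma shift_set_extremal:
  assumes fin: "finite (carrier G)" and AG: "A \<subseteq> carrier G" and DA: "D \<subseteq> A" and one: "\<one> \<in> D"
    and card: "card (shift_set G A D) = 2 * card D"
  shows "subgroup D G" "D \<subseteq> shift_set G A D"
    "\<exists>b. b \<in> shift_set G A D \<and> b \<notin> D \<and> shift_set G A D = D \<union> (D #> b)"
proof -
  have D: "finite D" "D \<subseteq> carrier G" using DA AG finite_subset[OF _ fin] by auto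
  have pos: "card D > 0" using one D by (auto simp: card_gt_0_iff)
  have diff: "x \<otimes> inv d \<in> shift_set G A D" if x: "x \<in> D" and d: "d \<in> D" for x d
  proof -
    obtain u where "u \<in> shift_set G A D" "x \<otimes> u \<notin> D"
      using shift_set_leaves[OF D x, of A] card pos by auto
    from card_nonreturning_shifts[OF fin AG DA x this] shift_set_returning(1)[OF D, of x A]
    have "card {v \<in> shift_set G A D. x \<otimes> inv v \<in> D} = card D"
      using card card_shift_set_split[OF fin, of A D x] x D by force
    from shift_set_returning(2)[OF D _ this d] show ?thesis using x D by blast
  qed
  \<comment> \<open>Adding the identity for q at w to the one for -q at w + 2q cancels
    \<open>A\<close> and leaves 2 D(w + q) = D(w) + D(w + 2q).\<close>
  have per: "w \<otimes> q \<in> D \<Longrightarrow> w \<in> D"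
    if q: "q \<in> shift_set G A D" "inv q \<in> shift_set G A D" and w: "w \<in> carrier G" for q w
  proof -
    have qc: "q \<in> carrier G" using q shift_set_carrier by blast
    have e: "w \<otimes> (q \<otimes> q) \<otimes> (inv q \<otimes> inv q) = w" "w \<otimes> (q \<otimes> q) \<otimes> inv q = w \<otimes> q"
      using w qc by (simp_all add: m_ac inv_cancel inv_cancel2)
    show "w \<otimes> q \<in> D \<Longrightarrow> w \<in> D"
      using shift_setD[OF q(1) w] shift_setD[OF q(2), of "w \<otimes> (q \<otimes> q)"] w qc unfolding e
      by (auto simp: of_bool_def split: if_splits)
  qed
  have sh: "d \<in> shift_set G A D" "inv d \<in> shift_set G A D" if d: "d \<in> D" for d
    using diff[OF d one] diff[OF one d] d D by auto
  show DE: "D \<subseteq> shift_set G A D" using sh by blast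
  have mult: "w \<otimes> d \<in> D" "w \<otimes> inv d \<in> D" if w: "w \<in> D" and d: "d \<in> D" for w d
  proof -
    have c: "w \<in> carrier G" "d \<in> carrier G" using w d D by auto
    have "w \<otimes> d \<otimes> inv d = w" "w \<otimes> inv d \<otimes> d = w" using c by (simp_all add: m_assoc)
    thus "w \<otimes> d \<in> D" "w \<otimes> inv d \<in> D"
      using per[of "inv d" "w \<otimes> d"] per[of d "w \<otimes> inv d"] sh[OF d] c w by auto
  qed
  show sub: "subgroup D G"
    using mult(2)[OF one] mult(1) D one by (intro subgroupI) (auto simp: subset_iff)
  \<comment> \<open>Half of the shifts lie outside \<open>D\<close>. Adding the periods in
    \<open>D\<close> to any one of them already produces that whole half.\<close>
  obtain b where b: "b \<in> shift_set G A D" "b \<notin> D"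
    using card pos card_mono[OF D(1), of "shift_set G A D"] by auto
  have bc: "b \<in> carrier G" using b shift_set_carrier by blast
  have "D \<subseteq> shift_periods A D"
  proof
    fix d assume d: "d \<in> D"
    have "w \<otimes> d \<in> D \<longleftrightarrow> w \<in> D" if "w \<in> carrier G" for w
      using per[OF sh[OF d] that] mult(1)[OF _ d] by blast
    thus "d \<in> shift_periods A D" using sh[OF d] by (simp add: shift_periods_def)
  qed
  hence "D #> b \<subseteq> shift_set G A D"
    using shift_set_mult_period[OF b(1)] bc D by (auto simp: r_coset_def) (metis m_comm subset_iff)
  moreover have "D \<inter> (D #> b) = {}"
  proof (rule ccontr)
    assume "D \<inter> (D #> b) \<noteq> {}"
    then obtain y where y: "y \<in> D" "y \<in> D #> b" by blast
    hence "D #> b = D #> y" using repr_independence[OF _ bc sub] by blast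
    also have "\<dots> = D" using coset_join2[OF _ sub] y D by blast
    finally show False using b rcos_self[OF bc sub] by simp
  qed
  moreover have "card (D #> b) = card D"
    using card_rcosets_equal[OF rcosetsI[OF D(2) bc] D(2)] by simp
  moreover have "finite (D #> b)" using D by (simp add: r_coset_def)
  ultimately have "card (D \<union> (D #> b)) = card (shift_set G A D)" "D \<union> (D #> b) \<subseteq> shift_set G A D"
    using card DE D by (auto simp: card_Un_disjoint)
  moreover have "finite (shift_set G A D)" using fin shift_set_carrier finite_subset by blast
  ultimately have "shift_set G A D = D \<union> (D #> b)" by (metis card_subset_eq)
  thus "\<exists>b. b \<in> shift_set G A D \<and> b \<notin> D \<and> shift_set G A D = D \<union> (D #> b)" using b by blast
qed

section \<open>Unrepresented elements\<close>

lemma subgroup_doubles: "subgroup (doubles G (carrier G)) G"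
proof (rule subgroupI)
  show "doubles G (carrier G) \<subseteq> carrier G" by (auto simp: doubles_def)
  show "doubles G (carrier G) \<noteq> {}" using one_closed by (auto simp: doubles_def)
  fix a assume "a \<in> doubles G (carrier G)"
  then obtain x where x: "x \<in> carrier G" "a = x \<otimes> x" by (auto simp: doubles_def)
  hence "inv a = inv x \<otimes> inv x" by (simp add: inv_mult)
  thus "inv a \<in> doubles G (carrier G)" using x by (auto simp: doubles_def)
  fix b assume "b \<in> doubles G (carrier G)"
  then obtain y where y: "y \<in> carrier G" "b = y \<otimes> y" by (auto simp: doubles_def)
  hence "a \<otimes> b = (x \<otimes> y) \<otimes> (x \<otimes> y)" using x by (simp add: m_ac)
  thus "a \<otimes> b \<in> doubles G (carrier G)" using x y by (auto simp: doubles_def)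
qed

text \<open>Doubling is a homomorphism with kernel \<open>K_grp G\<close>, so each non-empty fibre
  has L(G) elements.\<close>

lemma card_square_vimage:
  assumes fin: "finite (carrier G)"
  shows "card {x \<in> carrier G. x \<otimes> x \<in> W} = L_grp G * card (W \<inter> doubles G (carrier G))"
proof -
  let ?W = "W \<inter> doubles G (carrier G)"
  have fib: "card {x \<in> carrier G. x \<otimes> x = w} = L_grp G" if w: "w \<in> ?W" for w
  proof -
    obtain y where y: "y \<in> carrier G" "w = y \<otimes> y" using w by (auto simp: doubles_def)
    have "{x \<in> carrier G. x \<otimes> x = w} = (\<lambda>k. y \<otimes> k) ` K_grp G"
    proof (intro subset_antisym subsetI)
      fix x assume "x \<in> {x \<in> carrier G. x \<otimes> x = w}"
      hence x: "x \<in> carrier G" "x \<otimes> x = y \<otimes> y" using y by auto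
      have "(inv y \<otimes> x) \<otimes> (inv y \<otimes> x) = inv y \<otimes> (inv y \<otimes> (x \<otimes> x))"
        using x(1) y by (simp add: m_ac)
      also have "\<dots> = \<one>" unfolding x(2) using y by (simp add: inv_cancel)
      finally have "inv y \<otimes> x \<in> K_grp G" using x y by (simp add: K_grp_def)
      moreover have "x = y \<otimes> (inv y \<otimes> x)" using x y by (simp add: inv_cancel)
      ultimately show "x \<in> (\<lambda>k. y \<otimes> k) ` K_grp G" by blast
    next
      fix x assume "x \<in> (\<lambda>k. y \<otimes> k) ` K_grp G"
      then obtain k where k: "k \<in> carrier G" "k \<otimes> k = \<one>" "x = y \<otimes> k"
        by (auto simp: K_grp_def)
      have "x \<otimes> x = (y \<otimes> y) \<otimes> (k \<otimes> k)" using k(1,3) y by (simp add: m_ac)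
      thus "x \<in> {x \<in> carrier G. x \<otimes> x = w}" using k(1,3) y unfolding k(2) by simp
    qed
    moreover have "inj_on (\<lambda>k. y \<otimes> k) (K_grp G)" using y by (auto simp: K_grp_def intro!: inj_onI)
    ultimately show ?thesis by (simp add: card_image L_grp_def)
  qed
  have "{x \<in> carrier G. x \<otimes> x \<in> W} = (\<Union>w\<in>?W. {x \<in> carrier G. x \<otimes> x = w})"
    by (auto simp: doubles_def)
  moreover have "finite ?W" using fin by (simp add: doubles_def)
  hence "card (\<Union>w\<in>?W. {x \<in> carrier G. x \<otimes> x = w}) = (\<Sum>w\<in>?W. card {x \<in> carrier G. x \<otimes> x = w})"
    using fin by (intro card_UN_disjoint) auto
  ultimately show ?thesis using fib by simp
qed

lemma L_grp_pos: "finite (carrier G) \<Longrightarrow> L_grp G > 0"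
  unfolding L_grp_def by (auto simp: card_gt_0_iff K_grp_def)

text \<open>The representation z = x + (z - x) has difference 2x - z, so these are the x whose
  representation of z is forbidden by \<open>T\<close>: the set called D with index z in the
  introduction.\<close>

definition sqrt_set :: "'a \<Rightarrow> 'a set \<Rightarrow> 'a set"
  where "sqrt_set z T = {x \<in> carrier G. x \<otimes> x \<otimes> inv z \<in> T}"

lemma card_sqrt_set:
  assumes fin: "finite (carrier G)" and TG: "T \<subseteq> carrier G" and z: "z \<in> carrier G"
  shows "card (sqrt_set z T) = L_grp G * card {t \<in> T. t \<otimes> z \<in> doubles G (carrier G)}"
proof -
  have "sqrt_set z T = {x \<in> carrier G. x \<otimes> x \<in> (\<lambda>t. t \<otimes> z) ` T}"
  proof -
    have "x \<otimes> x \<otimes> inv z \<in> T \<longleftrightarrow> x \<otimes> x \<in> (\<lambda>t. t \<otimes> z) ` T" if x: "x \<in> carrier G" for x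
    proof
      assume "x \<otimes> x \<otimes> inv z \<in> T"
      moreover have "x \<otimes> x \<otimes> inv z \<otimes> z = x \<otimes> x" using x z by (simp add: m_assoc)
      ultimately show "x \<otimes> x \<in> (\<lambda>t. t \<otimes> z) ` T" by force
    next
      assume "x \<otimes> x \<in> (\<lambda>t. t \<otimes> z) ` T"
      then obtain t where t: "t \<in> T" "x \<otimes> x = t \<otimes> z" by blast
      hence "x \<otimes> x \<otimes> inv z = t" using TG z by (auto simp: m_assoc)
      thus "x \<otimes> x \<otimes> inv z \<in> T" using t by simp
    qed
    thus ?thesis by (auto simp: sqrt_set_def)
  qed
  moreover have "(\<lambda>t. t \<otimes> z) ` T \<inter> doubles G (carrier G) =
      (\<lambda>t. t \<otimes> z) ` {t \<in> T. t \<otimes> z \<in> doubles G (carrier G)}" by blast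
  moreover have "inj_on (\<lambda>t. t \<otimes> z) {t \<in> T. t \<otimes> z \<in> doubles G (carrier G)}"
    using TG z by (auto intro!: inj_onI simp: subset_iff)
  ultimately show ?thesis using card_square_vimage[OF fin] by (simp add: card_image)
qed

section \<open>Elements without an admissible representation\<close>

lemma not_restricted_sumset_iff:
  assumes AG: "A \<subseteq> carrier G" and BG: "B \<subseteq> carrier G" and z: "z \<in> carrier G"
  shows "z \<notin> restricted_sumset G T A B \<longleftrightarrow> {a \<in> A. inv a \<otimes> z \<in> B} \<subseteq> sqrt_set z T"
proof -
  have e: "a \<otimes> inv (inv a \<otimes> z) = a \<otimes> a \<otimes> inv z" if "a \<in> A" for a
    using that AG z by (auto simp: inv_mult m_assoc)
  have "z \<in> restricted_sumset G T A B \<longleftrightarrow> (\<exists>a\<in>A. inv a \<otimes> z \<in> B \<and> a \<otimes> inv (inv a \<otimes> z) \<notin> T)"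
  proof
    assume "z \<in> restricted_sumset G T A B"
    then obtain a b where ab: "a \<in> A" "b \<in> B" "z = a \<otimes> b" "a \<otimes> inv b \<notin> T"
      by (auto simp: restricted_sumset_def)
    moreover from this have "inv a \<otimes> z = b" using AG BG by (auto simp: inv_cancel subset_iff)
    ultimately show "\<exists>a\<in>A. inv a \<otimes> z \<in> B \<and> a \<otimes> inv (inv a \<otimes> z) \<notin> T" by metis
  next
    assume "\<exists>a\<in>A. inv a \<otimes> z \<in> B \<and> a \<otimes> inv (inv a \<otimes> z) \<notin> T"
    then obtain a where a: "a \<in> A" "inv a \<otimes> z \<in> B" "a \<otimes> inv (inv a \<otimes> z) \<notin> T" by blast
    moreover have "z = a \<otimes> (inv a \<otimes> z)" using a(1) AG z by (auto simp: inv_cancel)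
    ultimately show "z \<in> restricted_sumset G T A B" unfolding restricted_sumset_def by blast
  qed
  thus ?thesis using e AG by (auto simp: sqrt_set_def)
qed

text \<open>Inclusion-exclusion for \<open>A\<close> and z - \<open>B\<close>, whose sizes add up to
  |G| + n: they share at least n elements, and exactly n only if their union is G.\<close>

lemma representations_tight:
  assumes fin: "finite (carrier G)" and AG: "A \<subseteq> carrier G" and BG: "B \<subseteq> carrier G"
    and z: "z \<in> carrier G" and card: "card A + card B = order G + n"
  shows "n \<le> card {a \<in> A. inv a \<otimes> z \<in> B}"
    and "card {a \<in> A. inv a \<otimes> z \<in> B} \<le> n \<Longrightarrow> x \<in> carrier G \<Longrightarrow> x \<notin> A \<Longrightarrow> inv x \<otimes> z \<in> B"
proof -
  define Z where "Z = {x \<in> carrier G. inv x \<otimes> z \<in> B}"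
  have "bij_betw (\<lambda>x. inv x \<otimes> z) Z B"
  proof (rule bij_betwI[where g = "\<lambda>y. inv y \<otimes> z"])
    show "(\<lambda>x. inv x \<otimes> z) \<in> Z \<rightarrow> B" by (auto simp: Z_def)
    show "(\<lambda>y. inv y \<otimes> z) \<in> B \<rightarrow> Z"
      using BG z by (auto simp: Z_def inv_mult m_ac inv_cancel inv_cancel2 subset_iff)
  qed (use BG z in \<open>auto simp: Z_def inv_mult m_ac inv_cancel inv_cancel2 subset_iff\<close>)
  hence cZ: "card Z = card B" by (rule bij_betw_same_card)
  have fZ: "finite Z" "finite A" using fin AG finite_subset by (auto simp: Z_def)
  have I: "{a \<in> A. inv a \<otimes> z \<in> B} = A \<inter> Z" using AG by (auto simp: Z_def)
  have U: "card (A \<union> Z) + card (A \<inter> Z) = order G + n"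
    using card_Un_Int[OF fZ(2,1)] cZ card by simp
  have sub: "A \<union> Z \<subseteq> carrier G" using AG by (auto simp: Z_def)
  hence le: "card (A \<union> Z) \<le> order G" using fin by (simp add: order_def card_mono)
  show "n \<le> card {a \<in> A. inv a \<otimes> z \<in> B}" using U le I by simp
  assume "card {a \<in> A. inv a \<otimes> z \<in> B} \<le> n" and x: "x \<in> carrier G" "x \<notin> A"
  hence "card (A \<union> Z) = card (carrier G)" using U le I by (simp add: order_def)
  hence "A \<union> Z = carrier G" using card_subset_eq[OF fin sub] by simp
  thus "inv x \<otimes> z \<in> B" using x by (auto simp: Z_def)
qed

context
  fixes A B T :: "'a set"
  assumes fin: "finite (carrier G)" and AG: "A \<subseteq> carrier G" and BG: "B \<subseteq> carrier G"
    and TG: "T \<subseteq> carrier G" and card: "card A + card B = order G + L_grp G * card T"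
begin

text \<open>A squeeze. The number of representations of z is at least L(G)|T| by inclusion-exclusion
  and at most |sqrt_set z T| because all of them are forbidden; the latter is at most L(G)|T|
  because each t has at most L(G) roots. Equality holds throughout.\<close>

lemma unrepresented_structure:
  assumes z: "z \<in> carrier G - restricted_sumset G T A B"
  shows "t \<in> T \<Longrightarrow> t \<otimes> z \<in> doubles G (carrier G)"
    and "sqrt_set z T = {a \<in> A. inv a \<otimes> z \<in> B}"
    and "x \<in> carrier G \<Longrightarrow> inv x \<otimes> z \<in> B \<longleftrightarrow> x \<notin> A \<or> x \<in> sqrt_set z T"
    and "card (sqrt_set z T) = L_grp G * card T"
proof -
  let ?R = "{a \<in> A. inv a \<otimes> z \<in> B}" and ?T = "{t \<in> T. t \<otimes> z \<in> doubles G (carrier G)}"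
  have zc: "z \<in> carrier G" using z by blast
  have finT: "finite T" and finq: "finite (sqrt_set z T)"
    using TG fin finite_subset by (auto simp: sqrt_set_def)
  have sub: "?R \<subseteq> sqrt_set z T" using z not_restricted_sumset_iff[OF AG BG zc] by blast
  have 1: "L_grp G * card T \<le> card ?R" using representations_tight(1)[OF fin AG BG zc card] .
  have 2: "card ?R \<le> card (sqrt_set z T)" using card_mono[OF finq sub] .
  have 3: "card (sqrt_set z T) = L_grp G * card ?T" using card_sqrt_set[OF fin TG zc] .
  have 4: "card ?T \<le> card T" using finT by (intro card_mono) auto
  have "L_grp G * card T \<le> L_grp G * card ?T" using 1 2 3 by linarith
  hence 5: "card ?T = card T" using 4 L_grp_pos[OF fin] by simp
  hence "?T = T" using finT by (intro card_subset_eq) auto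
  thus "t \<in> T \<Longrightarrow> t \<otimes> z \<in> doubles G (carrier G)" by blast
  show 6: "card (sqrt_set z T) = L_grp G * card T" using 3 5 by simp
  show 7: "sqrt_set z T = ?R" using card_subset_eq[OF finq sub] 1 2 6 by simp
  assume x: "x \<in> carrier G"
  show "inv x \<otimes> z \<in> B \<longleftrightarrow> x \<notin> A \<or> x \<in> sqrt_set z T"
    using representations_tight(2)[OF fin AG BG zc card _ x] 6 7 by auto
qed

text \<open>The set \<open>sqrt_set\<close> for z + 2u is the one for z moved by u. So the shift
  identity says that the indicator of \<open>A\<close> minus that of \<open>sqrt_set\<close>, taken
  for z and moved by 2u, becomes the same function for z + 2u. For unrepresented elements both
  describe the complement of one and the same set \<open>B\<close>, as (z + 2u) - (w + 2u) = z -
  w.\<close>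

lemma shift_set_sqrt_set:
  assumes z: "z \<in> carrier G - restricted_sumset G T A B"
  shows "shift_set G A (sqrt_set z T) =
    {u \<in> carrier G. u \<otimes> u \<otimes> z \<in> carrier G - restricted_sumset G T A B}"
proof -
  let ?D = "sqrt_set z T"
  have zc: "z \<in> carrier G" using z by blast
  have DA: "?D \<subseteq> A" using unrepresented_structure(2)[OF z] by blast
  have Diff: "w \<otimes> u \<in> ?D \<longleftrightarrow> w \<otimes> (u \<otimes> u) \<in> sqrt_set (u \<otimes> u \<otimes> z) T"
    if "w \<in> carrier G" "u \<in> carrier G" for w u
  proof -
    have "w \<otimes> (u \<otimes> u) \<otimes> (w \<otimes> (u \<otimes> u)) \<otimes> inv (u \<otimes> u \<otimes> z) = w \<otimes> u \<otimes> (w \<otimes> u) \<otimes> inv z"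
      using that zc by (simp add: inv_mult m_ac inv_cancel inv_cancel2)
    thus ?thesis using that by (simp add: sqrt_set_def)
  qed
  have eB: "inv (w \<otimes> (u \<otimes> u)) \<otimes> (u \<otimes> u \<otimes> z) = inv w \<otimes> z"
    if "w \<in> carrier G" "u \<in> carrier G" for w u
    using that zc by (simp add: inv_mult m_ac inv_cancel inv_cancel2)
  have "u \<in> shift_set G A ?D \<longleftrightarrow> u \<otimes> u \<otimes> z \<notin> restricted_sumset G T A B"
    if u: "u \<in> carrier G" for u
  proof
    assume sh: "u \<in> shift_set G A ?D"
    have "a \<in> sqrt_set (u \<otimes> u \<otimes> z) T" if a: "a \<in> A" "inv a \<otimes> (u \<otimes> u \<otimes> z) \<in> B" for a
    proof -
      define w where "w = a \<otimes> inv (u \<otimes> u)"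
      have ac: "a \<in> carrier G" using a AG by blast
      hence w: "w \<in> carrier G" "w \<otimes> (u \<otimes> u) = a" using u by (simp_all add: w_def m_assoc)
      have "inv w \<otimes> z \<in> B" using eB[OF w(1) u] a(2) w(2) by simp
      hence "w \<notin> A \<or> w \<in> ?D" using unrepresented_structure(3)[OF z w(1)] by simp
      hence "w \<otimes> u \<in> ?D"
        using shift_setD[OF sh w(1)] a(1) w(2) DA by (auto simp: of_bool_def split: if_splits)
      thus ?thesis using Diff[OF w(1) u] w(2) by simp
    qed
    thus "u \<otimes> u \<otimes> z \<notin> restricted_sumset G T A B"
      using not_restricted_sumset_iff[OF AG BG, of "u \<otimes> u \<otimes> z" T] u zc by auto
  next
    assume "u \<otimes> u \<otimes> z \<notin> restricted_sumset G T A B"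
    hence z': "u \<otimes> u \<otimes> z \<in> carrier G - restricted_sumset G T A B" using u zc by simp
    have "of_bool (w \<otimes> (u \<otimes> u) \<in> A) - of_bool (w \<in> A) =
       (of_bool (w \<otimes> u \<in> ?D) - of_bool (w \<in> ?D) :: int)" if w: "w \<in> carrier G" for w
    proof -
      have "w \<otimes> (u \<otimes> u) \<notin> A \<or> w \<otimes> u \<in> ?D \<longleftrightarrow> w \<notin> A \<or> w \<in> ?D"
        using unrepresented_structure(3)[OF z w]
          unrepresented_structure(3)[OF z', of "w \<otimes> (u \<otimes> u)"] Diff[OF w u] eB[OF w u] w u by simp
      moreover have "w \<otimes> u \<in> ?D \<Longrightarrow> w \<otimes> (u \<otimes> u) \<in> A"
        using unrepresented_structure(2)[OF z'] Diff[OF w u] by blast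
      ultimately show ?thesis using DA by (auto simp: of_bool_def)
    qed
    thus "u \<in> shift_set G A ?D" using u by (simp add: shift_set_def)
  qed
  thus ?thesis using shift_set_carrier[of A ?D] zc by auto
qed

text \<open>Unrepresented elements are congruent modulo 2G, so each is z + 2u, for exactly L(G)
  values of u.\<close>

lemma card_shift_set_sqrt_set:
  assumes z: "z \<in> carrier G - restricted_sumset G T A B" and "T \<noteq> {}"
  shows "card (shift_set G A (sqrt_set z T)) =
    L_grp G * card (carrier G - restricted_sumset G T A B)"
proof -
  let ?E = "carrier G - restricted_sumset G T A B"
  let ?W = "(\<lambda>y. y \<otimes> inv z) ` ?E"
  have zc: "z \<in> carrier G" using z by blast
  have "u \<otimes> u \<otimes> z \<in> ?E \<longleftrightarrow> u \<otimes> u \<in> ?W" if u: "u \<in> carrier G" for u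
  proof
    assume a: "u \<otimes> u \<otimes> z \<in> ?E"
    have "u \<otimes> u = (u \<otimes> u \<otimes> z) \<otimes> inv z" using u zc by (simp add: m_assoc)
    thus "u \<otimes> u \<in> ?W" using a by (rule image_eqI)
  next
    assume "u \<otimes> u \<in> ?W"
    then obtain y where y: "y \<in> ?E" "u \<otimes> u = y \<otimes> inv z" by blast
    moreover have "y \<otimes> inv z \<otimes> z = y" using y(1) zc by (simp add: m_assoc)
    ultimately show "u \<otimes> u \<otimes> z \<in> ?E" by simp
  qed
  hence "shift_set G A (sqrt_set z T) = {u \<in> carrier G. u \<otimes> u \<in> ?W}"
    unfolding shift_set_sqrt_set[OF z] by blast
  moreover have "?W \<subseteq> doubles G (carrier G)"
  proof
    fix w assume "w \<in> ?W"
    then obtain y where y: "y \<in> ?E" "w = y \<otimes> inv z" by blast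
    obtain t where t: "t \<in> T" using assms(2) by blast
    have "t \<otimes> y \<otimes> inv (t \<otimes> z) \<in> doubles G (carrier G)"
      using unrepresented_structure(1)[OF y(1) t] unrepresented_structure(1)[OF z t]
        subgroup_doubles by (meson subgroup.m_closed subgroup.m_inv_closed)
    moreover have "t \<otimes> y \<otimes> inv (t \<otimes> z) = w"
      using y t zc TG by (auto simp: inv_mult m_ac inv_cancel inv_cancel2 subset_iff)
    ultimately show "w \<in> doubles G (carrier G)" by simp
  qed
  moreover have "card ?W = card ?E" using zc by (intro card_image) (auto intro!: inj_onI)
  ultimately show ?thesis using card_square_vimage[OF fin, of ?W] by (simp add: Int_absorb2)
qed

text \<open>The number of shifts is L(G) times the number of unrepresented elements, and it is at
  most 2 |sqrt_set z T| = 2 L(G) |T|.\<close>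

lemma card_unrepresented_le:
  assumes "T \<noteq> {}"
  shows "card (carrier G - restricted_sumset G T A B) \<le> 2 * card T"
proof (cases "carrier G - restricted_sumset G T A B = {}")
  case True
  thus ?thesis by (metis card.empty zero_le)
next
  case False
  then obtain z where z: "z \<in> carrier G - restricted_sumset G T A B" by blast
  have c: "card (sqrt_set z T) = L_grp G * card T" using unrepresented_structure(4)[OF z] .
  have "finite T" using TG fin finite_subset by blast
  hence "card T > 0" using assms by (simp add: card_gt_0_iff)
  hence "sqrt_set z T \<noteq> {}" using c L_grp_pos[OF fin] by auto
  moreover have "sqrt_set z T \<subseteq> A" using unrepresented_structure(2)[OF z] by blast
  ultimately have "L_grp G * card (carrier G - restricted_sumset G T A B) \<le> 2 * (L_grp G * card T)"
    using card_shift_set_le[OF fin AG] card_shift_set_sqrt_set[OF z assms] c by metis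
  thus ?thesis using L_grp_pos[OF fin] by simp
qed

end

section \<open>The numbers L_S(z)\<close>

text \<open>The elements z and -z are congruent modulo 2G.\<close>

lemma mem_doubles_coset_iff:
  assumes "t \<in> carrier G" "z \<in> carrier G"
  shows "t \<in> doubles G (carrier G) #> z \<longleftrightarrow> t \<otimes> z \<in> doubles G (carrier G)"
proof -
  interpret Q: subgroup "doubles G (carrier G)" G by (rule subgroup_doubles)
  have zz: "z \<otimes> z \<in> doubles G (carrier G)" using assms by (simp add: doubles_def)
  have "t \<in> doubles G (carrier G) #> z \<longleftrightarrow> t \<otimes> inv z \<in> doubles G (carrier G)"
    using Q.rcos_module[OF is_group assms(2,1)] .
  also have "\<dots> \<longleftrightarrow> t \<otimes> z \<in> doubles G (carrier G)"
  proof -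
    have "t \<otimes> inv z \<otimes> (z \<otimes> z) = t \<otimes> z" "t \<otimes> z \<otimes> inv (z \<otimes> z) = t \<otimes> inv z"
      using assms by (simp_all add: inv_mult m_ac inv_cancel inv_cancel2)
    thus ?thesis using zz Q.m_closed Q.m_inv_closed by metis
  qed
  finally show ?thesis .
qed

text \<open>A solution is determined by its first component, which runs over
  \<open>sqrt_set z S\<close>.\<close>

lemma L_at_eq:
  assumes fin: "finite (carrier G)" and SG: "S \<subseteq> carrier G" and z: "z \<in> carrier G"
  shows "L_at G S z = L_grp G * card (S \<inter> (doubles G (carrier G) #> z))"
proof -
  let ?X = "{(x, y). x \<in> carrier G \<and> y \<in> carrier G \<and> x \<otimes> y = z \<and> x \<otimes> inv y \<in> S}"
  have "bij_betw fst ?X (sqrt_set z S)"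
  proof (rule bij_betwI[where g = "\<lambda>x. (x, inv x \<otimes> z)"])
    have e: "x \<otimes> x \<otimes> inv (x \<otimes> y) = x \<otimes> inv y" if "x \<in> carrier G" "y \<in> carrier G" for x y
      using that by (simp add: inv_mult m_ac inv_cancel inv_cancel2)
    show "fst \<in> ?X \<rightarrow> sqrt_set z S" using e by (auto simp: sqrt_set_def)
    show "(\<lambda>x. (x, inv x \<otimes> z)) \<in> sqrt_set z S \<rightarrow> ?X"
      using z by (auto simp: sqrt_set_def inv_mult m_ac inv_cancel inv_cancel2)
  qed (auto simp: sqrt_set_def inv_cancel)
  hence "L_at G S z = card (sqrt_set z S)" unfolding L_at_def by (rule bij_betw_same_card)
  also have "\<dots> = L_grp G * card {t \<in> S. t \<otimes> z \<in> doubles G (carrier G)}"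
    by (rule card_sqrt_set[OF fin SG z])
  also have "{t \<in> S. t \<otimes> z \<in> doubles G (carrier G)} = S \<inter> (doubles G (carrier G) #> z)"
    using SG z mem_doubles_coset_iff by blast
  finally show ?thesis .
qed

end

section \<open>Decomposition of \<open>S\<close> modulo doubles\<close>

text \<open>\<open>card_unrep\<close> is the hypothesis on the size of the restricted sumset in
  complementary form; by \<open>set_mult_eq_carrier\<close> this complement is the set of
  exceptions.\<close>

locale extremal_pair = comm_group G for G (structure) +
  fixes A B S :: "'a set"
  assumes finite_carrier: "finite (carrier G)" and AG: "A \<subseteq> carrier G" and BG: "B \<subseteq> carrier G"
    and SG: "S \<subseteq> carrier G" and card_AB: "card A + card B = order G + L_max G S"
    and one_S: "\<one> \<in> S" and one_unrep: "\<one> \<notin> restricted_sumset G S A B"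
    and card_unrep: "card (carrier G - restricted_sumset G S A B) = 2 * card S"
begin

abbreviation "Q \<equiv> doubles G (carrier G)"
abbreviation "unrep T \<equiv> carrier G - restricted_sumset G T A B"
abbreviation "parts \<equiv> decomposition_mod_doubles G S"

lemma L_grp_mult_card_le_L_max:
  assumes "z \<in> carrier G" shows "L_grp G * card (S \<inter> (Q #> z)) \<le> L_max G S"
  unfolding L_max_def L_at_eq[OF finite_carrier SG assms, symmetric]
  using assms finite_carrier by (intro Max_ge) auto

lemma L_max_pos: "L_max G S > 0"
proof -
  have "\<one> \<in> S \<inter> (Q #> \<one>)" using one_S rcos_self[OF one_closed subgroup_doubles] by blast
  moreover have "finite S" using finite_subset[OF SG finite_carrier] .
  ultimately have "card (S \<inter> (Q #> \<one>)) > 0" by (metis card_gt_0_iff empty_iff finite_Int)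
  thus ?thesis
    using L_grp_mult_card_le_L_max[OF one_closed] L_grp_pos[OF finite_carrier] by (metis gr0I leD mult_pos_pos)
qed

text \<open>The difference 2a - z of any representation of z is congruent to z modulo 2G, so only
  the part of \<open>S\<close> in that coset can forbid it.\<close>

lemma sum_mem_coset:
  assumes "a \<in> carrier G" "z \<in> carrier G"
  shows "a \<otimes> a \<otimes> inv z \<in> Q #> z"
proof -
  have "a \<otimes> a \<otimes> inv z \<otimes> z = a \<otimes> a" using assms by (simp add: m_assoc)
  thus ?thesis using mem_doubles_coset_iff[of "a \<otimes> a \<otimes> inv z" z] assms by (auto simp: doubles_def)
qed

lemma ex_representation:
  assumes "z \<in> carrier G" obtains a where "a \<in> A" "inv a \<otimes> z \<in> B"
proof -
  have "card {a \<in> A. inv a \<otimes> z \<in> B} > 0"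
    using representations_tight(1)[OF finite_carrier AG BG assms card_AB] L_max_pos by linarith
  thus ?thesis using that by (fastforce simp: card_gt_0_iff)
qed

text \<open>Every z has at least L_S > 0 representations.\<close>

lemma set_mult_eq_carrier: "A <#> B = carrier G"
proof
  show "A <#> B \<subseteq> carrier G" using AG BG by (auto simp: set_mult_def subset_iff)
  show "carrier G \<subseteq> A <#> B"
  proof
    fix z assume z: "z \<in> carrier G"
    then obtain a where a: "a \<in> A" "inv a \<otimes> z \<in> B" using ex_representation by blast
    moreover have "z = a \<otimes> (inv a \<otimes> z)" using a z AG by (auto simp: inv_cancel subset_iff)
    ultimately show "z \<in> A <#> B" unfolding set_mult_def by blast
  qed
qed

lemma unrep_mono: "T \<subseteq> T' \<Longrightarrow> unrep T \<subseteq> unrep T'"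
  unfolding restricted_sumset_def by blast

text \<open>All representations of z, at least L_S in number, are forbidden by this one part. It
  forbids at most L(G) times its size, so it attains the maximum L_S.\<close>

lemma unrep_coset_part:
  assumes z: "z \<in> unrep S"
  shows "z \<in> unrep (S \<inter> (Q #> z))" "L_grp G * card (S \<inter> (Q #> z)) = L_max G S"
proof -
  let ?T = "S \<inter> (Q #> z)"
  have zc: "z \<in> carrier G" using z by blast
  have "{a \<in> A. inv a \<otimes> z \<in> B} \<subseteq> sqrt_set z S"
    using z not_restricted_sumset_iff[OF AG BG zc] by blast
  also have "\<dots> \<subseteq> sqrt_set z ?T" using sum_mem_coset[OF _ zc] by (auto simp: sqrt_set_def)
  finally have sub: "{a \<in> A. inv a \<otimes> z \<in> B} \<subseteq> sqrt_set z ?T" .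
  thus "z \<in> unrep ?T" using zc not_restricted_sumset_iff[OF AG BG zc] by blast
  have fT: "finite ?T" "?T \<subseteq> carrier G" using finite_subset[OF SG finite_carrier] SG by auto
  have "L_max G S \<le> card (sqrt_set z ?T)"
    using representations_tight(1)[OF finite_carrier AG BG zc card_AB] card_mono[OF _ sub]
      finite_carrier by (force simp: sqrt_set_def)
  also have "\<dots> = L_grp G * card {t \<in> ?T. t \<otimes> z \<in> Q}"
    using card_sqrt_set[OF finite_carrier fT(2) zc] .
  also have "\<dots> \<le> L_grp G * card ?T" using fT by (intro mult_le_mono card_mono) auto
  finally show "L_grp G * card ?T = L_max G S" using L_grp_mult_card_le_L_max[OF zc] by simp
qed

text \<open>Some representation of z exists and is forbidden, and its difference lies in the cosets
  of both y and z. Consequently the sets \<open>unrep T\<close> for different parts are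
  disjoint.\<close>

lemma unrep_part_coset:
  assumes y: "y \<in> carrier G" and z: "z \<in> unrep (S \<inter> (Q #> y))"
  shows "Q #> z = Q #> y"
proof -
  have zc: "z \<in> carrier G" using z by blast
  obtain a where a: "a \<in> A" "inv a \<otimes> z \<in> B" using ex_representation[OF zc] .
  hence "a \<in> sqrt_set z (S \<inter> (Q #> y))" using z not_restricted_sumset_iff[OF AG BG zc] by blast
  hence "a \<otimes> a \<otimes> inv z \<in> Q #> y" "a \<in> carrier G" by (auto simp: sqrt_set_def)
  thus ?thesis using sum_mem_coset[of a z] zc y subgroup_doubles repr_independence by metis
qed

lemma partsD:
  assumes "T \<in> parts"
  obtains y where "y \<in> carrier G" "T = S \<inter> (Q #> y)"
  using assms unfolding decomposition_mod_doubles_def RCOSETS_def by blast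

lemma part_nonempty: "T \<in> parts \<Longrightarrow> T \<noteq> {}"
  unfolding decomposition_mod_doubles_def by blast

lemma parts_eqI:
  assumes "T \<in> parts" "T' \<in> parts" "t \<in> T" "t \<in> T'"
  shows "T = T'"
proof -
  obtain y y' where y: "y \<in> carrier G" "T = S \<inter> (Q #> y)" "y' \<in> carrier G" "T' = S \<inter> (Q #> y')"
    using assms partsD by metis
  hence "Q #> y = Q #> t" "Q #> y' = Q #> t"
    using assms repr_independence[OF _ _ subgroup_doubles] by blast+
  thus ?thesis using y by simp
qed

lemma coset_part_in_parts: "z \<in> carrier G \<Longrightarrow> S \<inter> (Q #> z) \<noteq> {} \<Longrightarrow> S \<inter> (Q #> z) \<in> parts"
  unfolding decomposition_mod_doubles_def RCOSETS_def by blast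

lemma finite_parts: "finite parts"
proof -
  have "parts \<subseteq> Pow S" unfolding decomposition_mod_doubles_def by blast
  thus ?thesis using finite_subset[OF SG finite_carrier] by (meson finite_Pow_iff finite_subset)
qed

lemma unrep_eq_Union_parts: "unrep S = (\<Union>T\<in>parts. unrep T)"
proof
  show "unrep S \<subseteq> (\<Union>T\<in>parts. unrep T)"
  proof
    fix z assume z: "z \<in> unrep S"
    have "S \<inter> (Q #> z) \<noteq> {}" using unrep_coset_part(2)[OF z] L_max_pos by auto
    hence "S \<inter> (Q #> z) \<in> parts" using coset_part_in_parts z by blast
    thus "z \<in> (\<Union>T\<in>parts. unrep T)" using unrep_coset_part(1)[OF z] by blast
  qed
  show "(\<Union>T\<in>parts. unrep T) \<subseteq> unrep S"
  proof (rule UN_least)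
    fix T assume "T \<in> parts"
    hence "T \<subseteq> S" by (auto elim: partsD)
    thus "unrep T \<subseteq> unrep S" by (rule unrep_mono)
  qed
qed

lemma unrep_parts_eqI:
  assumes "T \<in> parts" "T' \<in> parts" "z \<in> unrep T" "z \<in> unrep T'"
  shows "T = T'"
proof -
  obtain y y' where y: "y \<in> carrier G" "T = S \<inter> (Q #> y)" "y' \<in> carrier G" "T' = S \<inter> (Q #> y')"
    using assms partsD by metis
  hence "Q #> z = Q #> y" "Q #> z = Q #> y'"
    using assms unrep_part_coset by blast+
  thus ?thesis using y by simp
qed

lemma card_part_if_unrep:
  assumes T: "T \<in> parts" and z: "z \<in> unrep T"
  shows "L_grp G * card T = L_max G S"
proof -
  obtain y where y: "y \<in> carrier G" "T = S \<inter> (Q #> y)" using partsD[OF T] .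
  have "z \<in> unrep S" using T z unrep_eq_Union_parts by blast
  moreover have "Q #> z = Q #> y" using unrep_part_coset y z by blast
  ultimately show ?thesis using unrep_coset_part(2)[of z] y by simp
qed

lemma part_subset: "T \<in> parts \<Longrightarrow> T \<subseteq> carrier G"
  using SG by (auto elim: partsD)

text \<open>The sets \<open>unrep T\<close> partition \<open>unrep S\<close> and each has at most
  2|T| elements. The total is 2|S|, the sum of these bounds, so no part falls short.\<close>

lemma card_unrep_part:
  assumes T: "T \<in> parts"
  shows "card (unrep T) = 2 * card T"
proof -
  have fin: "finite (unrep T)" for T using finite_carrier by simp
  have le: "card (unrep T) \<le> 2 * card T" if T: "T \<in> parts" for T
  proof (cases "unrep T = {}")
    case True
    thus ?thesis by (metis card.empty zero_le)
  next
    case False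
    then obtain z where "z \<in> unrep T" by blast
    \<comment> \<open>The size condition in \<open>card_unrepresented_le\<close> is known at this
      stage only because \<open>unrep T\<close> is non-empty.\<close>
    from card_part_if_unrep[OF T this] show ?thesis
      using card_unrepresented_le[OF finite_carrier AG BG part_subset[OF T] _ part_nonempty[OF T]]
        card_AB by simp
  qed
  have "S = \<Union>parts"
  proof
    show "S \<subseteq> \<Union>parts"
    proof
      fix s assume s: "s \<in> S"
      hence "s \<in> S \<inter> (Q #> s)" using SG rcos_self[OF _ subgroup_doubles] by blast
      thus "s \<in> \<Union>parts" using coset_part_in_parts[of s] s SG by blast
    qed
  qed (auto elim: partsD)
  moreover have "card (\<Union>parts) = (\<Sum>T\<in>parts. card T)"
  proof (rule card_Union_disjoint)
    show "disjoint parts" using parts_eqI by (force simp: pairwise_def disjnt_def)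
    show "\<And>T. T \<in> parts \<Longrightarrow> finite T" using part_subset finite_subset finite_carrier by blast
  qed
  ultimately have "2 * card S = (\<Sum>T\<in>parts. 2 * card T)" by (simp add: sum_distrib_left)
  moreover have "card (unrep S) = (\<Sum>T\<in>parts. card (unrep T))"
    unfolding unrep_eq_Union_parts using finite_parts fin unrep_parts_eqI
    by (intro card_UN_disjoint) blast+
  ultimately have "(\<Sum>T\<in>parts. card (unrep T)) = (\<Sum>T\<in>parts. 2 * card T)"
    using card_unrep by simp
  \<comment> \<open>Truncated subtraction is harmless by \<open>le\<close>; a vanishing sum of
    deficits makes every deficit zero.\<close>
  hence "(\<Sum>T\<in>parts. 2 * card T - card (unrep T)) = 0"
    using le by (simp add: sum_subtractf_nat)
  hence "2 * card T - card (unrep T) = 0" using finite_parts T by simp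
  thus ?thesis using le[OF T] by simp
qed

text \<open>Having 2|T| > 0 unrepresented elements, every part falls under
  \<open>card_part_if_unrep\<close>.\<close>

lemma card_part:
  assumes T: "T \<in> parts"
  shows "L_grp G * card T = L_max G S"
proof -
  have "card T > 0"
    using part_nonempty[OF T] part_subset[OF T] finite_carrier by (meson card_gt_0_iff finite_subset)
  hence "unrep T \<noteq> {}" using card_unrep_part[OF T] by (metis card.empty mult_is_0 not_gr0 zero_neq_numeral)
  thus ?thesis using card_part_if_unrep[OF T] by blast
qed

lemma card_AB_part: "T \<in> parts \<Longrightarrow> card A + card B = order G + L_grp G * card T"
  using card_AB card_part by simp

end

section \<open>Structure of the pair over an element with a double of odd order\<close>

locale odd_double = comm_group G for G (structure) +
  fixes b :: 'a
  assumes finite_carrier: "finite (carrier G)" and b: "b \<in> carrier G"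
    and odd_ord: "odd (ord (b \<otimes> b))" and ord_gt_1: "1 < ord (b \<otimes> b)"
begin

definition "h = b \<otimes> b"
definition "d = ord (b \<otimes> b)"
text \<open>The inverse of 2 modulo the odd number d, and the length of the progressions
  below.\<close>

definition "e = (d + 1) div 2"
abbreviation "K \<equiv> K_grp G"
abbreviation "H \<equiv> generate G {b \<otimes> b}"

lemma d_eq: "2 * e = d + 1" "2 \<le> e"
proof -
  have "odd d" "1 < d" using odd_ord ord_gt_1 by (auto simp: d_def)
  thus "2 * e = d + 1" "2 \<le> e" unfolding e_def by presburger+
qed

lemma h_carrier: "h \<in> carrier G" using b by (simp add: h_def)

lemma h_pow_d: "h [^] d = \<one>" using h_carrier by (simp add: d_def h_def)

lemma h_pow_mod: "h [^] (i mod d) = h [^] i"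
proof -
  have "h [^] i = h [^] (d * (i div d)) \<otimes> h [^] (i mod d)"
    using h_carrier by (simp add: nat_pow_mult)
  thus ?thesis using h_carrier h_pow_d by (simp add: nat_pow_pow[symmetric])
qed

lemma H_eq: "H = {h [^] i | i. i < d}"
proof -
  have "H = {h [^] k | k. k \<in> (UNIV :: nat set)}"
    using generate_pow_on_finite_carrier[OF finite_carrier h_carrier] by (simp add: h_def)
  moreover have "h [^] k \<in> {h [^] i | i. i < d}" for k :: nat
    using h_pow_mod[of k] d_eq
    by (intro CollectI exI[of _ "k mod d"]) simp
  ultimately show ?thesis by auto
qed

lemma card_H: "card H = d"
  using generate_pow_card[of "b \<otimes> b"] b by (simp add: d_def)

lemma subgroup_H: "subgroup H G" using generate_is_subgroup[of "{b \<otimes> b}"] b by simp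

lemma h_pow_in_H: "h [^] (i::nat) \<in> H"
  using subgroup_H h_carrier generate.incl[of h "{h}" G] unfolding h_def[symmetric]
  by (induction i) (auto simp: subgroup.one_closed subgroup.m_closed)

lemma subgroup_K: "subgroup K G"
proof (rule subgroupI)
  fix k assume k: "k \<in> K"
  thus "inv k \<in> K" by (auto simp: K_grp_def inv_mult[symmetric])
  fix l assume l: "l \<in> K"
  have "k \<in> carrier G" "l \<in> carrier G" using k l by (auto simp: K_grp_def)
  hence "k \<otimes> l \<otimes> (k \<otimes> l) = (k \<otimes> k) \<otimes> (l \<otimes> l)" by (simp add: m_ac)
  thus "k \<otimes> l \<in> K" using k l by (simp add: K_grp_def)
qed (auto simp: K_grp_def)

lemma K_carrier: "k \<in> K \<Longrightarrow> k \<in> carrier G" by (simp add: K_grp_def)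

lemma inv_K: "k \<in> K \<Longrightarrow> inv k = k"
  by (auto simp: K_grp_def intro: inv_equality)

text \<open>A multiple i h lies in \<open>K\<close> only if d divides 2i, hence i, as d is odd; thus
  \<open>K\<close> and \<open>H\<close> meet trivially.\<close>

lemma K_mult_h_pow_in_K_iff:
  assumes k: "k \<in> K"
  shows "k \<otimes> h [^] (i::nat) \<in> K \<longleftrightarrow> d dvd i"
proof -
  have "k \<otimes> h [^] i \<otimes> (k \<otimes> h [^] i) = (k \<otimes> k) \<otimes> (h [^] i \<otimes> h [^] i)"
    using K_carrier[OF k] h_carrier by (simp add: m_ac)
  also have "\<dots> = h [^] (2 * i)"
    using k h_carrier by (simp add: K_grp_def nat_pow_mult mult_2)
  finally have "k \<otimes> h [^] i \<in> K \<longleftrightarrow> h [^] (2 * i) = \<one>"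
    using K_carrier[OF k] h_carrier by (simp add: K_grp_def)
  also have "\<dots> \<longleftrightarrow> d dvd 2 * i" using pow_eq_id[OF h_carrier] by (simp add: d_def h_def)
  also have "\<dots> \<longleftrightarrow> d dvd i" using odd_ord by (simp add: d_def coprime_dvd_mult_right_iff)
  finally show ?thesis .
qed

lemma b_pow_d_in_K: "b [^] d \<in> K"
proof -
  have "b [^] d \<otimes> b [^] d = h [^] d" using b by (simp add: h_def nat_pow_distrib)
  thus ?thesis using b h_pow_d by (simp add: K_grp_def)
qed

text \<open>Since (d + 1) b = e h, the element b agrees with e h up to d b, which lies in
  \<open>K\<close>. In particular b lies in K + H.\<close>

lemma b_eq: "b = b [^] d \<otimes> h [^] e"
proof -
  have "h [^] e = b [^] (d + 1)" using b d_eq by (simp add: h_def nat_pow_distrib nat_pow_mult mult_2[symmetric])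
  also have "\<dots> = b [^] d \<otimes> b" by simp
  finally have "b [^] d \<otimes> h [^] e = (b [^] d \<otimes> b [^] d) \<otimes> b" using b by (simp add: m_assoc)
  thus ?thesis using b_pow_d_in_K b by (simp add: K_grp_def)
qed

section \<open>The subgroup K + H and the odd multiples of b\<close>

lemma KH_eq: "K <#> H = {k \<otimes> h [^] i | k i. k \<in> K \<and> i < d}"
  unfolding set_mult_def H_eq by blast

lemma K_mult_h_pow_in_KH: "k \<in> K \<Longrightarrow> k \<otimes> h [^] (i::nat) \<in> K <#> H"
  using h_pow_in_H unfolding set_mult_def by blast

lemma subgroup_KH: "subgroup (K <#> H) G"
  using mult_subgroups subgroup_H subgroup_K by blast

lemma b_in_KH: "b \<in> K <#> H"
  using K_mult_h_pow_in_KH[OF b_pow_d_in_K, of e] b_eq by simp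

text \<open>Up to d b in \<open>K\<close>, the multiple (2j + 1) b is (j + e) h, and 2j + 1 <= d - 2
  means j + e <= d - 1. So modulo \<open>K\<close> the set is the run e h, ..., (d - 1) h, d h = 0
  of e consecutive multiples of h.\<close>

lemma odd_multiples_eq:
  "zero_odd_multiples G b d <#> K = {k \<otimes> h [^] i | k i. k \<in> K \<and> i < d \<and> (i = 0 \<or> e \<le> i)}"
proof -
  have pow: "b [^] (2 * j + 1) = b [^] d \<otimes> h [^] (j + e)" for j
  proof -
    have "b [^] (2 * j + 1) = h [^] j \<otimes> b" using b by (simp add: h_def nat_pow_distrib nat_pow_mult mult_2)
    also have "\<dots> = h [^] j \<otimes> (b [^] d \<otimes> h [^] e)" using b_eq by simp
    also have "\<dots> = b [^] d \<otimes> h [^] (j + e)"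
      using b h_carrier by (simp add: nat_pow_mult[symmetric] m_ac)
    finally show ?thesis .
  qed
  show ?thesis
  proof (intro subset_antisym subsetI)
    fix x assume "x \<in> zero_odd_multiples G b d <#> K"
    then obtain y k where yk: "y \<in> zero_odd_multiples G b d" "k \<in> K" "x = y \<otimes> k"
      unfolding set_mult_def by blast
    show "x \<in> {k \<otimes> h [^] i | k i. k \<in> K \<and> i < d \<and> (i = 0 \<or> e \<le> i)}"
    proof (cases "y = \<one>")
      case True
      hence "x = k \<otimes> h [^] (0::nat)" using yk K_carrier by simp
      moreover have "0 < d" using d_eq by simp
      ultimately show ?thesis using yk by blast
    next
      case False
      then obtain j where j: "odd j" "j + 2 \<le> d" "y = b [^] j"
        using yk unfolding zero_odd_multiples_def by blast
      obtain i where i: "j = 2 * i + 1" using j(1) by (metis oddE)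
      have "x = (b [^] d \<otimes> k) \<otimes> h [^] (i + e)"
        unfolding yk(3) j(3) i pow using K_carrier[OF yk(2)] b h_carrier by (simp add: m_ac)
      moreover have "b [^] d \<otimes> k \<in> K"
        using b_pow_d_in_K yk subgroup_K by (simp add: subgroup.m_closed)
      moreover have "i + e < d" "e \<le> i + e" using i j d_eq by linarith+
      ultimately show ?thesis by blast
    qed
  next
    fix x assume "x \<in> {k \<otimes> h [^] i | k i. k \<in> K \<and> i < d \<and> (i = 0 \<or> e \<le> i)}"
    then obtain k i where ki: "k \<in> K" "i < d" "i = 0 \<or> e \<le> i" "x = k \<otimes> h [^] i" by blast
    show "x \<in> zero_odd_multiples G b d <#> K"
    proof (cases "i = 0")
      case True
      hence "x = \<one> \<otimes> k" using ki K_carrier by simp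
      moreover have "\<one> \<in> zero_odd_multiples G b d" by (simp add: zero_odd_multiples_def)
      ultimately show ?thesis using ki unfolding set_mult_def by blast
    next
      case False
      then obtain j where j: "i = j + e" using ki by (metis add.commute le_Suc_ex)
      have "b [^] (2 * j + 1) \<in> zero_odd_multiples G b d"
        using ki j d_eq unfolding zero_odd_multiples_def
        by (intro insertI2 CollectI exI[of _ "2 * j + 1"]) auto
      moreover have "b [^] d \<otimes> k \<in> K"
        using b_pow_d_in_K ki subgroup_K by (simp add: subgroup.m_closed)
      moreover have "x = b [^] (2 * j + 1) \<otimes> (b [^] d \<otimes> k)"
      proof -
        have "b [^] (2 * j + 1) \<otimes> (b [^] d \<otimes> k) = (b [^] d \<otimes> b [^] d) \<otimes> (k \<otimes> h [^] i)"
          unfolding pow j using b h_carrier K_carrier[OF ki(1)] by (simp add: m_ac)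
        also have "\<dots> = x" using b_pow_d_in_K ki(4) K_carrier[OF ki(1)] h_carrier by (simp add: K_grp_def)
        finally show ?thesis by (rule sym)
      qed
      ultimately show ?thesis unfolding set_mult_def by blast
    qed
  qed
qed

section \<open>The pattern of A along cosets of H\<close>

text \<open>The exponents e, ..., d - 1, 0 are cyclically consecutive, so in each coset k + H the
  set is a progression with difference h. Outside K + H, periodicity under one step h amounts to
  periodicity under \<open>H\<close>.\<close>

definition odd_pattern :: "'a set \<Rightarrow> bool"
  where "odd_pattern A \<longleftrightarrow>
    (\<forall>k\<in>K. \<forall>i<d. k \<otimes> h [^] i \<in> A \<longleftrightarrow> i = 0 \<or> e \<le> i) \<and>
    (\<forall>w\<in>carrier G - (K <#> H). w \<otimes> h \<in> A \<longleftrightarrow> w \<in> A)"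

lemma mult_b_in_K_iff:
  assumes k: "k \<in> K"
  shows "k \<otimes> h [^] (i::nat) \<otimes> b \<in> K \<longleftrightarrow> d dvd i + e"
proof -
  have "k \<otimes> h [^] i \<otimes> b = k \<otimes> h [^] i \<otimes> (b [^] d \<otimes> h [^] e)" using b_eq by simp
  also have "\<dots> = (k \<otimes> b [^] d) \<otimes> h [^] (i + e)"
    using b h_carrier K_carrier[OF k] by (simp add: nat_pow_mult[symmetric] m_ac)
  finally show ?thesis
    using K_mult_h_pow_in_K_iff[of "k \<otimes> b [^] d"] k b_pow_d_in_K subgroup_K
    by (simp add: subgroup.m_closed)
qed

lemma outside_KH:
  assumes w: "w \<in> carrier G - (K <#> H)"
  shows "w \<notin> K" "w \<otimes> b \<notin> K"
proof -
  interpret KH: subgroup "K <#> H" G by (rule subgroup_KH)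
  have sub: "K \<subseteq> K <#> H"
    using K_mult_h_pow_in_KH[of _ 0] K_carrier by (metis nat_pow_0 r_one subsetI)
  thus "w \<notin> K" using w by blast
  show "w \<otimes> b \<notin> K"
  proof
    assume "w \<otimes> b \<in> K"
    hence "w \<otimes> b \<otimes> inv b \<in> K <#> H" using sub b_in_KH by blast
    moreover have "w \<otimes> b \<otimes> inv b = w" using w b by (simp add: m_assoc)
    ultimately show False using w by simp
  qed
qed

text \<open>As 0 < i + e < 2d, the only possible multiple is d itself, and d - e = e - 1.\<close>

lemma dvd_add_e_iff: "i < d \<Longrightarrow> d dvd i + e \<longleftrightarrow> i + 1 = e"
proof -
  assume i: "i < d"
  have "d dvd i + e \<longleftrightarrow> i + e = d"
  proof
    assume "d dvd i + e"
    then obtain c where c: "i + e = d * c" by (elim dvdE)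
    have "i + e < d * 2" "0 < i + e" using i d_eq by linarith+
    hence "c < 2" "c \<noteq> 0" unfolding c by simp_all
    hence "c = 1" by linarith
    thus "i + e = d" using c by simp
  qed simp
  thus "d dvd i + e \<longleftrightarrow> i + 1 = e" using d_eq by auto
qed

text \<open>Walk along k + i h. Membership in \<open>A\<close> is lost only on leaving i = 0, where
  the point is in \<open>K\<close>, and regained only on the step from e - 1 to e, where adding b to
  the point leads into \<open>K\<close>. Outside K + H neither event occurs.\<close>

lemma shift_set_imp_odd_pattern:
  assumes KA: "K \<subseteq> A" and sh: "b \<in> shift_set G A K"
  shows "odd_pattern A"
proof -
  have step: "of_bool (w \<otimes> h \<in> A) - of_bool (w \<in> A) =
     (of_bool (w \<otimes> b \<in> K) - of_bool (w \<in> K) :: int)" if "w \<in> carrier G" for w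
    using shift_setD[OF sh that] by (simp add: h_def)
  have "k \<otimes> h [^] i \<in> A \<longleftrightarrow> i = 0 \<or> e \<le> i" if k: "k \<in> K" and "i < d" for k i
    using \<open>i < d\<close>
  proof (induction i)
    case 0
    thus ?case using KA k K_carrier by auto
  next
    case (Suc i)
    let ?w = "k \<otimes> h [^] i"
    have w: "?w \<in> carrier G" "k \<otimes> h [^] Suc i = ?w \<otimes> h"
      using K_carrier[OF k] h_carrier by (simp_all add: m_assoc)
    have wK: "?w \<in> K \<longleftrightarrow> i = 0"
      using K_mult_h_pow_in_K_iff[OF k, of i] Suc by (auto dest: dvd_imp_le)
    have wbK: "?w \<otimes> b \<in> K \<longleftrightarrow> i + 1 = e"
      using mult_b_in_K_iff[OF k, of i] dvd_add_e_iff[of i] Suc by simp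
    show ?case unfolding w(2) using step[OF w(1)] wK wbK Suc d_eq
      by (auto simp: of_bool_def split: if_splits)
  qed
  moreover have "w \<otimes> h \<in> A \<longleftrightarrow> w \<in> A" if w: "w \<in> carrier G - (K <#> H)" for w
    using step[of w] outside_KH[OF w] w by (auto simp: of_bool_def split: if_splits)
  ultimately show ?thesis unfolding odd_pattern_def by blast
qed

lemma outside_KH_mult_iff:
  assumes "w \<in> carrier G" "y \<in> H"
  shows "w \<otimes> y \<in> K <#> H \<longleftrightarrow> w \<in> K <#> H"
proof -
  interpret KH: subgroup "K <#> H" G by (rule subgroup_KH)
  have yc: "y \<in> carrier G" using assms subgroup.mem_carrier[OF subgroup_H] by blast
  have y: "y \<in> K <#> H"
    using assms yc subgroup.one_closed[OF subgroup_K] unfolding set_mult_def by force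
  have "w = w \<otimes> y \<otimes> inv y" using assms yc by (simp add: m_assoc)
  thus ?thesis using y KH.m_closed KH.m_inv_closed by metis
qed

lemma odd_pattern_periodic:
  assumes A: "odd_pattern A" and w: "w \<in> carrier G - (K <#> H)" and y: "y \<in> H"
  shows "w \<otimes> y \<in> A \<longleftrightarrow> w \<in> A"
proof -
  have "w \<otimes> h [^] i \<in> A \<longleftrightarrow> w \<in> A" for i :: nat
  proof (induction i)
    case 0
    thus ?case using w by simp
  next
    case (Suc i)
    have "w \<otimes> h [^] i \<in> carrier G - (K <#> H)"
      using outside_KH_mult_iff[OF _ h_pow_in_H, of w i] w h_carrier by simp
    moreover have "w \<otimes> h [^] Suc i = w \<otimes> h [^] i \<otimes> h" using w h_carrier by (simp add: m_assoc)
    ultimately show ?case using A Suc unfolding odd_pattern_def by metis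
  qed
  thus ?thesis using y unfolding H_eq by blast
qed

lemma K_mult_h_pow_inj:
  assumes "k \<in> K" "k' \<in> K" "i < d" "j < d" and eq: "k \<otimes> h [^] i = k' \<otimes> h [^] j"
  shows "i = j" "k = k'"
proof -
  have *: "i = j" if "k \<in> K" "k' \<in> K" "i < d" "j < d" "k \<otimes> h [^] i = k' \<otimes> h [^] j" "i \<le> j"
    for k k' :: 'a and i j :: nat
  proof -
    have "h [^] j = h [^] (j - i) \<otimes> h [^] i" using h_carrier that by (simp add: nat_pow_mult)
    hence "k \<otimes> h [^] i = k' \<otimes> h [^] (j - i) \<otimes> h [^] i"
      using that(5) K_carrier[OF that(2)] h_carrier by (simp add: m_assoc)
    hence "k = k' \<otimes> h [^] (j - i)" using K_carrier that h_carrier by simp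
    hence "d dvd j - i" using K_mult_h_pow_in_K_iff[OF that(2)] that(1) by simp
    thus ?thesis using that by (auto dest!: dvd_imp_le)
  qed
  show ij: "i = j" using *[of k k' i j] *[of k' k j i] assms by (metis linear)
  show "k = k'" using eq K_carrier assms h_carrier unfolding ij by simp
qed

section \<open>Rigidity of the pattern under translation\<close>

text \<open>In each coset of \<open>H\<close> inside K + H, \<open>A\<close> has a run of e
  exponents and A - K one of e - 1. The shorter run fits into the longer one only after a shift by 0
  or by h, and the end point left uncovered is in \<open>K\<close> or in K + b accordingly.\<close>

lemma translate_rigid:
  assumes A: "odd_pattern A" and DA: "D \<subseteq> A" and cD: "card D = card K" and fD: "finite D"
    and z: "z \<in> carrier G"
    and eq: "\<And>w. w \<in> carrier G \<Longrightarrow> w \<otimes> z \<in> A - D \<longleftrightarrow> w \<in> A - K"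
  shows "(z \<in> K \<and> D = K) \<or> ((\<exists>k\<in>K. z = k \<otimes> h) \<and> D = (\<lambda>k. k \<otimes> b) ` K)"
proof -
  interpret K: subgroup K G by (rule subgroup_K)
  interpret KH: subgroup "K <#> H" G by (rule subgroup_KH)
  have AK: "k \<otimes> h [^] i \<in> A \<longleftrightarrow> i = 0 \<or> e \<le> i" if "k \<in> K" "i < d" for k i
    using A that unfolding odd_pattern_def by blast
  have eD: "e < d" "1 < d" "1 < e" using d_eq by linarith+
  have hpos: "k \<otimes> h [^] i \<in> K \<longleftrightarrow> i = 0" if "k \<in> K" "i < d" for k i
    using K_mult_h_pow_in_K_iff[OF that(1), of i] that(2) by (auto dest: dvd_imp_le)
  have eq': "y \<in> A - D \<longleftrightarrow> y \<otimes> inv z \<in> A - K" if "y \<in> carrier G" for y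
    using eq[of "y \<otimes> inv z"] that z by (simp add: m_assoc)
  have KA: "k \<in> A" if "k \<in> K" for k using AK[OF that, of 0] that eD K_carrier by simp
  have finK: "finite K" by (rule finite_subset[OF K.subset finite_carrier])
  have inj: "inj_on (\<lambda>k. k \<otimes> y) K" if "y \<in> carrier G" for y
    by (rule inj_onI) (use that K_carrier in \<open>blast dest: right_cancel[THEN iffD1, rotated -1]\<close>)
  have "z \<in> K <#> H"
  proof (rule ccontr)
    assume zn: "z \<notin> K <#> H"
    \<comment> \<open>If z is outside K + H, translation by z brings in values of \<open>A\<close>
      from outside K + H, where \<open>A\<close> is H-periodic; so A - D is constant on k +
      H.\<close>
    have const: "k \<otimes> h [^] i \<in> A - D \<longleftrightarrow> k \<otimes> inv z \<in> A - K" if k: "k \<in> K" for k and i :: nat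
    proof -
      have kc: "k \<in> carrier G" using K_carrier[OF k] .
      have kKH: "k \<in> K <#> H" using K_mult_h_pow_in_KH[OF k, of 0] kc by simp
      have "k \<otimes> inv z \<notin> K <#> H"
      proof
        assume "k \<otimes> inv z \<in> K <#> H"
        hence "inv (k \<otimes> inv z) \<otimes> k \<in> K <#> H" using kKH by blast
        moreover have "inv (k \<otimes> inv z) \<otimes> k = z"
          using kc z by (simp add: inv_mult m_ac inv_cancel inv_cancel2)
        ultimately show False using zn by simp
      qed
      hence w: "k \<otimes> inv z \<in> carrier G - (K <#> H)" using kc z by simp
      have w': "k \<otimes> inv z \<otimes> h [^] i \<in> carrier G - (K <#> H)"
        using outside_KH_mult_iff[OF _ h_pow_in_H, of "k \<otimes> inv z" i] w h_carrier by simp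
      have "k \<otimes> h [^] i \<otimes> inv z = k \<otimes> inv z \<otimes> h [^] i"
        using kc z h_carrier by (simp add: m_ac)
      thus ?thesis
        using eq'[of "k \<otimes> h [^] i"] odd_pattern_periodic[OF A w h_pow_in_H, of i]
          outside_KH(1)[OF w] outside_KH(1)[OF w'] kc h_carrier by simp
    qed
    \<comment> \<open>Since e >= 2, the point k + h is not in \<open>A\<close>, so the constant
      value is false.\<close>
    have none: "k \<otimes> h [^] i \<notin> A - D" if k: "k \<in> K" for k and i :: nat
      using const[OF k, of i] const[OF k, of 1] AK[OF k, of 1] eD by simp
    \<comment> \<open>Then \<open>D\<close> has to contain both \<open>K\<close> and K + e h, twice
      as many elements as it has.\<close>
    have "K \<subseteq> D" using none[of _ 0] KA K_carrier by (metis DiffI nat_pow_0 r_one subsetI)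
    moreover have "(\<lambda>k. k \<otimes> h [^] e) ` K \<subseteq> D" using none[of _ e] AK[of _ e] eD by blast
    ultimately have "card (K \<union> (\<lambda>k. k \<otimes> h [^] e) ` K) \<le> card D" using fD by (intro card_mono) auto
    moreover have "K \<inter> (\<lambda>k. k \<otimes> h [^] e) ` K = {}" using hpos[of _ e] eD by auto
    hence "card (K \<union> (\<lambda>k. k \<otimes> h [^] e) ` K) = card K + card K"
      using finK inj[of "h [^] e"] h_carrier by (simp add: card_Un_disjoint card_image)
    moreover have "card K > 0" using finK K.one_closed by (metis card_gt_0_iff empty_iff)
    ultimately show False using cD by linarith
  qed
  then obtain k0 i where ki: "k0 \<in> K" "i < d" "z = k0 \<otimes> h [^] i" unfolding KH_eq by blast
  have in_A: "k0 \<otimes> h [^] (j + i) \<in> A" if "e \<le> j" "j < d" for j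
  proof -
    have "h [^] j \<in> A - K"
      using AK[OF K.one_closed that(2)] hpos[OF K.one_closed that(2)] that eD h_carrier by simp
    hence "h [^] j \<otimes> z \<in> A" using eq[of "h [^] j"] h_carrier by simp
    moreover have "h [^] j \<otimes> z = k0 \<otimes> h [^] (j + i)"
      using ki(3) K_carrier[OF ki(1)] h_carrier by (simp add: nat_pow_mult[symmetric] m_ac)
    ultimately show ?thesis by simp
  qed
  \<comment> \<open>If i >= 2, the end d - 1 of the short run moves to i - 1 and forces i - 1 >= e.
    Then its start e moves to e + i - d, strictly between 0 and e, which is the gap of
    \<open>A\<close>.\<close>
  have i01: "i = 0 \<or> i = 1"
  proof (rule ccontr)
    assume "\<not> ?thesis"
    hence i2: "2 \<le> i" by linarith
    have pd: "h [^] (d + c) = h [^] c" for c using h_carrier h_pow_d by (simp add: nat_pow_mult[symmetric])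
    have "k0 \<otimes> h [^] (d - 1 + i) \<in> A" using in_A[of "d - 1"] eD by simp
    moreover have "d - 1 + i = d + (i - 1)" using i2 eD by linarith
    ultimately have "k0 \<otimes> h [^] (i - 1) \<in> A" using pd by simp
    hence "e \<le> i - 1" using AK[OF ki(1), of "i - 1"] ki(2) i2 by simp
    hence c: "e + i = d + (e + i - d)" "1 \<le> e + i - d" "e + i - d < e" "e + i - d < d"
      using d_eq ki(2) by linarith+
    have "k0 \<otimes> h [^] (e + i - d) \<in> A" using in_A[of e] eD c(1) pd by (metis le_refl)
    thus False using AK[OF ki(1) c(4)] c by linarith
  qed
  show ?thesis
  proof (cases "i = 0")
    case True
    hence zK: "z \<in> K" using ki K_carrier by simp
    have "K \<subseteq> D" using eq' KA K_carrier zK by blast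
    hence "D = K" using card_subset_eq[OF fD, of K] cD by simp
    thus ?thesis using zK by blast
  next
    case False
    hence zk: "z = k0 \<otimes> h" using ki i01 h_carrier by simp
    \<comment> \<open>Such a point has exponent e, so it is in \<open>A\<close>, but moving it back
      by z gives exponent e - 1 in the gap. Hence it is not in A - D.\<close>
    have "(\<lambda>k. k \<otimes> b) ` K \<subseteq> D"
    proof
      fix y assume "y \<in> (\<lambda>k. k \<otimes> b) ` K"
      then obtain k where k: "k \<in> K" "y = k \<otimes> b" by blast
      define k1 where "k1 = k \<otimes> b [^] d"
      have k1: "k1 \<in> K" using k b_pow_d_in_K by (simp add: k1_def)
      have "k \<otimes> b = k \<otimes> (b [^] d \<otimes> h [^] e)" using b_eq by simp
      hence y: "y = k1 \<otimes> h [^] e" using k K_carrier b h_carrier by (simp add: k1_def m_assoc)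
      have yA: "y \<in> A" using AK[OF k1 eD(1)] y by simp
      have "h [^] e = h [^] (e - 1) \<otimes> h" using eD nat_pow_Suc[of h "e - 1"] by simp
      hence "y \<otimes> inv z = k1 \<otimes> inv k0 \<otimes> h [^] (e - 1)"
        using y zk K_carrier k1 ki(1) h_carrier by (simp add: inv_mult m_ac inv_cancel inv_cancel2)
      moreover have "k1 \<otimes> inv k0 \<otimes> h [^] (e - 1) \<notin> A"
        using AK[of "k1 \<otimes> inv k0" "e - 1"] k1 ki(1) eD by simp
      ultimately have "y \<notin> A - D" using eq'[of y] y k1 K_carrier h_carrier by simp
      thus "y \<in> D" using yA by blast
    qed
    moreover have "card ((\<lambda>k. k \<otimes> b) ` K) = card D" using inj[OF b] cD by (simp add: card_image)
    ultimately have "D = (\<lambda>k. k \<otimes> b) ` K" using card_subset_eq[OF fD] by metis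
    thus ?thesis using zk ki by blast
  qed
qed

section \<open>Explicitly described sets have the pattern\<close>

lemma odd_multiples_mem_iff:
  assumes "k \<in> K" "i < d"
  shows "k \<otimes> h [^] i \<in> zero_odd_multiples G b d <#> K \<longleftrightarrow> i = 0 \<or> e \<le> i"
  unfolding odd_multiples_eq using assms K_mult_h_pow_inj(1)[OF assms(1) _ assms(2)] by blast

lemma signed_part_outside:
  assumes X: "x ` {1..m} \<subseteq> carrier G - (K <#> H)" and "k \<le> m" "q \<le> m"
  shows "signed_part G H x k p q \<subseteq> carrier G - (K <#> H)"
proof
  interpret KH: subgroup "K <#> H" G by (rule subgroup_KH)
  fix w assume "w \<in> signed_part G H x k p q"
  then obtain v y where vy: "y \<in> H" "w = v \<otimes> y"
    and "v \<in> x ` {1..k} \<union> x ` {p+1..q} \<union> (\<lambda>i. inv (x i)) ` {p+1..q}"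
    unfolding signed_part_def set_mult_def by blast
  hence "\<exists>i\<in>{1..m}. v = x i \<or> v = inv (x i)"
    using assms(2,3) by (elim UnE imageE) (rule bexI, blast, simp)+
  then obtain i where i: "i \<in> {1..m}" "v = x i \<or> v = inv (x i)" by blast
  have xi: "x i \<in> carrier G" "x i \<notin> K <#> H" using X i by blast+
  hence v: "v \<in> carrier G" "v \<notin> K <#> H" using i KH.m_inv_closed by (auto, metis inv_inv)
  thus "w \<in> carrier G - (K <#> H)"
    using outside_KH_mult_iff[OF v(1) vy(1)] vy subgroup.mem_carrier[OF subgroup_H] by auto
qed

text \<open>The piece X + H is invariant under h and avoids K + H, so the two clauses are governed
  separately by the run of odd multiples and by \<open>X\<close>.\<close>

lemma odd_pattern_odd_multiples_Un:
  assumes Q: "X <#> H \<subseteq> carrier G - (K <#> H)" and X: "X \<subseteq> carrier G"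
  shows "odd_pattern ((zero_odd_multiples G b d <#> K) \<union> (X <#> H))"
proof -
  interpret H: subgroup H G by (rule subgroup_H)
  have hH: "h \<in> H" using h_pow_in_H[of 1] h_carrier by simp
  have J: "zero_odd_multiples G b d <#> K \<subseteq> K <#> H"
    unfolding odd_multiples_eq KH_eq by blast
  have "w \<otimes> h \<in> X <#> H \<longleftrightarrow> w \<in> X <#> H" if w: "w \<in> carrier G" for w
  proof
    assume "w \<otimes> h \<in> X <#> H"
    then obtain v y where vy: "v \<in> X" "y \<in> H" "w \<otimes> h = v \<otimes> y" unfolding set_mult_def by blast
    have "w = w \<otimes> h \<otimes> inv h" using w h_carrier by (simp add: m_assoc)
    also have "\<dots> = v \<otimes> (y \<otimes> inv h)" unfolding vy(3) using vy X h_carrier by (auto simp: m_assoc)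
    finally show "w \<in> X <#> H" using vy hH unfolding set_mult_def by blast
  next
    assume "w \<in> X <#> H"
    then obtain v y where vy: "v \<in> X" "y \<in> H" "w = v \<otimes> y" unfolding set_mult_def by blast
    have "w \<otimes> h = v \<otimes> (y \<otimes> h)" unfolding vy(3) using vy X h_carrier by (auto simp: m_assoc)
    thus "w \<otimes> h \<in> X <#> H" using vy hH unfolding set_mult_def by blast
  qed
  moreover have "w \<otimes> h \<in> K <#> H \<longleftrightarrow> w \<in> K <#> H" if "w \<in> carrier G" for w
    using outside_KH_mult_iff[OF that hH] .
  moreover have "k \<otimes> h [^] i \<notin> X <#> H" if "k \<in> K" for k and i :: nat
    using K_mult_h_pow_in_KH[OF that, of i] Q by blast
  ultimately show ?thesis using J odd_multiples_mem_iff unfolding odd_pattern_def by blast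
qed

section \<open>Cosets of H up to sign\<close>

lemma outside_KH_inv: "w \<in> carrier G - (K <#> H) \<Longrightarrow> inv w \<in> carrier G - (K <#> H)"
  using subgroup.m_inv_closed[OF subgroup_KH, of "inv w"] by auto

text \<open>One block of the covering in the theorem; by \<open>sym_coset_eq\<close> these blocks
  are the classes of an equivalence relation.\<close>

definition "sym_coset w = (H #> w) \<union> (H #> inv w)"

lemma sym_coset_self: "w \<in> carrier G \<Longrightarrow> w \<in> sym_coset w" "w \<in> carrier G \<Longrightarrow> inv w \<in> sym_coset w"
  using rcos_self[OF _ subgroup_H] by (auto simp: sym_coset_def)

lemma mem_H_rcoset: "w \<in> carrier G \<Longrightarrow> v \<in> H #> w \<longleftrightarrow> (\<exists>y\<in>H. v = w \<otimes> y)"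
  using subgroup.mem_carrier[OF subgroup_H] by (auto simp: r_coset_def m_comm)

lemma inv_mem_H_rcoset: "w \<in> carrier G \<Longrightarrow> v \<in> H #> w \<Longrightarrow> inv v \<in> H #> inv w"
  using subgroup.mem_carrier[OF subgroup_H] subgroup.m_inv_closed[OF subgroup_H]
  by (force simp: mem_H_rcoset inv_mult)

lemma sym_coset_eq:
  assumes w: "w \<in> carrier G" and v: "v \<in> sym_coset w"
  shows "sym_coset v = sym_coset w"
proof -
  have "v \<in> H #> w \<or> v \<in> H #> inv w" using v by (simp add: sym_coset_def)
  thus ?thesis
  proof
    assume v: "v \<in> H #> w"
    have "H #> v = H #> w" using repr_independence[OF v w subgroup_H] by simp
    moreover have "H #> inv v = H #> inv w"
      using repr_independence[OF inv_mem_H_rcoset[OF w v] _ subgroup_H] w by simp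
    ultimately show ?thesis by (simp add: sym_coset_def)
  next
    assume v: "v \<in> H #> inv w"
    have wi: "inv w \<in> carrier G" using w by simp
    have "H #> v = H #> inv w" using repr_independence[OF v wi subgroup_H] by simp
    moreover have "H #> inv v = H #> w"
      using repr_independence[OF inv_mem_H_rcoset[OF wi v] _ subgroup_H] w by simp
    ultimately show ?thesis by (auto simp: sym_coset_def)
  qed
qed

lemma sym_coset_outside:
  assumes w: "w \<in> carrier G - (K <#> H)"
  shows "sym_coset w \<subseteq> carrier G - (K <#> H)"
proof
  fix v assume "v \<in> sym_coset w"
  then obtain u y where u: "u = w \<or> u = inv w" "y \<in> H" "v = u \<otimes> y"
    using w unfolding sym_coset_def by (auto simp: mem_H_rcoset)
  have "u \<in> carrier G - (K <#> H)" using u(1) w outside_KH_inv by blast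
  thus "v \<in> carrier G - (K <#> H)"
    using outside_KH_mult_iff[of u y] u subgroup.mem_carrier[OF subgroup_H] by auto
qed

text \<open>If 2w = i h, then j h with j = i e has the same double, as 2e is 1 modulo d; so w - j h
  lies in \<open>K\<close>. Outside K + H this makes w + H and -w + H disjoint.\<close>

lemma square_in_H_imp:
  assumes w: "w \<in> carrier G" and ww: "w \<otimes> w \<in> H"
  shows "w \<in> K <#> H"
proof -
  obtain i :: nat where i: "w \<otimes> w = h [^] i" using ww unfolding H_eq by blast
  define j where "j = i * e"
  have "j + j = i * (2 * e)" by (simp add: j_def)
  also have "\<dots> = d * i + i" unfolding d_eq(1) by simp
  finally have "h [^] j \<otimes> h [^] j = h [^] (d * i + i)" using h_carrier by (simp add: nat_pow_mult)
  also have "\<dots> = (h [^] d) [^] i \<otimes> h [^] i" using h_carrier by (simp add: nat_pow_mult nat_pow_pow)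
  also have "\<dots> = h [^] i" using h_pow_d h_carrier by simp
  finally have j: "h [^] j \<otimes> h [^] j = w \<otimes> w" using i by simp
  have "w \<otimes> inv (h [^] j) \<otimes> (w \<otimes> inv (h [^] j)) = w \<otimes> w \<otimes> inv (h [^] j \<otimes> h [^] j)"
    using w h_carrier by (simp add: inv_mult m_ac)
  also have "\<dots> = \<one>" unfolding j using w by simp
  finally have "w \<otimes> inv (h [^] j) \<in> K" using w h_carrier by (simp add: K_grp_def)
  from K_mult_h_pow_in_KH[OF this, of j] show ?thesis using w h_carrier by (simp add: m_assoc)
qed

lemma card_sym_coset:
  assumes w: "w \<in> carrier G - (K <#> H)"
  shows "card (sym_coset w) = 2 * d"
proof -
  have wc: "w \<in> carrier G" "inv w \<in> carrier G" using w by auto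
  have "(H #> w) \<inter> (H #> inv w) = {}"
  proof (rule ccontr)
    assume "\<not> ?thesis"
    then obtain v where v: "v \<in> H #> w" "v \<in> H #> inv w" by blast
    hence "H #> w = H #> inv w"
      using repr_independence[OF v(1) wc(1) subgroup_H] repr_independence[OF v(2) wc(2) subgroup_H] by simp
    hence "w \<in> H #> inv w" using rcos_self[OF wc(1) subgroup_H] by simp
    hence "w \<otimes> inv (inv w) \<in> H" using subgroup.rcos_module_imp[OF subgroup_H is_group wc(2)] by blast
    thus False using square_in_H_imp[OF wc(1)] w by simp
  qed
  moreover have HG: "H \<subseteq> carrier G" using subgroup.subset[OF subgroup_H] .
  have "card (H #> w) = d" "card (H #> inv w) = d"
    using card_rcosets_equal[OF rcosetsI[OF HG wc(1)] HG]
      card_rcosets_equal[OF rcosetsI[OF HG wc(2)] HG] card_H by auto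
  moreover have "finite (H #> w)" "finite (H #> inv w)"
    using finite_subset[OF HG finite_carrier] by (auto simp: r_coset_def)
  ultimately show ?thesis by (simp add: sym_coset_def card_Un_disjoint)
qed

lemma card_KH: "card (K <#> H) = L_grp G * d"
proof -
  have "K <#> H = (\<lambda>(k, i). k \<otimes> h [^] i) ` (K \<times> {..<d})" unfolding KH_eq by auto
  moreover have "inj_on (\<lambda>(k, i). k \<otimes> h [^] i) (K \<times> {..<d})"
    using K_mult_h_pow_inj by (auto intro!: inj_onI)
  ultimately show ?thesis by (simp add: card_image L_grp_def card_cartesian_product)
qed

text \<open>The representatives are chosen in \<open>A\<close> whenever possible, so that a representative outside \<open>A\<close>
  has its inverse outside \<open>A\<close> as well.\<close>

lemma ex_representatives:
  obtains X where "X \<subseteq> carrier G - (K <#> H)"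
    "carrier G - (K <#> H) = (\<Union>v\<in>X. sym_coset v)"
    "real (card X) = (real (order G) / real d - real (L_grp G)) / 2"
    "\<And>v. v \<in> X \<Longrightarrow> inv v \<in> A \<Longrightarrow> v \<in> A"
proof -
  let ?W = "carrier G - (K <#> H)"
  define C where "C = sym_coset ` ?W"
  have CW: "c \<subseteq> ?W" if "c \<in> C" for c using that sym_coset_outside by (auto simp: C_def)
  have cls: "sym_coset v = c" if "c \<in> C" "v \<in> c" for c v
    using that sym_coset_eq by (auto simp: C_def)
  have "\<exists>v\<in>c. c \<inter> A \<noteq> {} \<longrightarrow> v \<in> A" if "c \<in> C" for c
  proof -
    have "c \<noteq> {}" using that sym_coset_self by (auto simp: C_def)
    thus ?thesis by blast
  qed
  then obtain r where r: "\<And>c. c \<in> C \<Longrightarrow> r c \<in> c" "\<And>c. c \<in> C \<Longrightarrow> c \<inter> A \<noteq> {} \<Longrightarrow> r c \<in> A"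
    by metis
  define X where "X = r ` C"
  have inj: "inj_on r C" using cls r(1) by (metis inj_onI)
  have XW: "X \<subseteq> ?W" using r(1) CW by (auto simp: X_def)
  have UC: "?W = \<Union>C" using CW sym_coset_self by (auto simp: C_def)
  have "(\<Union>v\<in>X. sym_coset v) = \<Union>C" unfolding X_def using cls r(1) by auto
  hence U: "?W = (\<Union>v\<in>X. sym_coset v)" using UC by simp
  have "card ?W = (\<Sum>c\<in>C. card c)" unfolding UC
  proof (rule card_Union_disjoint)
    show "disjoint C" unfolding pairwise_def disjnt_def using cls by blast
    show "\<And>c. c \<in> C \<Longrightarrow> finite c" using CW finite_carrier by (meson finite_Diff finite_subset)
  qed
  also have "\<dots> = (\<Sum>c\<in>C. 2 * d)" using card_sym_coset by (intro sum.cong) (auto simp: C_def)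
  finally have cW: "card ?W = card X * (2 * d)" using card_image[OF inj] by (simp add: X_def)
  have KHG: "K <#> H \<subseteq> carrier G" using subgroup.subset[OF subgroup_KH] .
  hence "card ?W + L_grp G * d = order G"
    using card_Diff_subset[OF finite_subset[OF KHG finite_carrier] KHG] card_KH
      card_mono[OF finite_carrier KHG] by (simp add: order_def)
  \<comment> \<open>Solving this for |X| gives the prescribed number m of representatives.\<close>
  hence "order G = card X * (2 * d) + L_grp G * d" using cW by simp
  moreover have "d > 0" using d_eq by linarith
  ultimately have card: "real (card X) = (real (order G) / real d - real (L_grp G)) / 2"
    by (simp add: field_simps)
  have "v \<in> A" if v: "v \<in> X" "inv v \<in> A" for v
  proof -
    obtain c where c: "c \<in> C" "v = r c" using v(1) by (auto simp: X_def)
    have "sym_coset v = c" using cls c r(1) by auto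
    moreover have "v \<in> carrier G" using v XW by blast
    ultimately have "inv v \<in> c" using sym_coset_self(2) by blast
    thus ?thesis using r(2)[OF c(1)] v(2) c by blast
  qed
  thus ?thesis using that[OF XW U card] by blast
qed

section \<open>From the pattern to the explicit description\<close>

text \<open>For 0 < i < d, inversion sends exponent i to d - i, and e <= d - i holds exactly when i
  < e. So reflection followed by complementation reproduces the run, with exponent 0 restored by the
  clause on \<open>K\<close>.\<close>

lemma odd_pattern_inv_complement:
  assumes A: "odd_pattern A"
  shows "odd_pattern {x \<in> carrier G. inv x \<notin> A \<or> inv x \<in> K}" (is "odd_pattern ?B")
proof -
  have inv_pow: "inv (k \<otimes> h [^] i) = k \<otimes> h [^] (d - i)" if "k \<in> K" "i \<le> d" for k i
  proof (rule inv_equality)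
    have "k \<otimes> h [^] (d - i) \<otimes> (k \<otimes> h [^] i) = (k \<otimes> k) \<otimes> (h [^] (d - i) \<otimes> h [^] i)"
      using K_carrier[OF that(1)] h_carrier by (simp add: m_ac)
    also have "\<dots> = \<one>" using that h_carrier h_pow_d by (simp add: K_grp_def nat_pow_mult)
    finally show "k \<otimes> h [^] (d - i) \<otimes> (k \<otimes> h [^] i) = \<one>" .
  qed (use that K_carrier h_carrier in auto)
  have "k \<otimes> h [^] i \<in> ?B \<longleftrightarrow> i = 0 \<or> e \<le> i" if k: "k \<in> K" and i: "i < d" for k i
  proof (cases "i = 0")
    case True
    thus ?thesis using k K_carrier inv_K by simp
  next
    case False
    have "inv (k \<otimes> h [^] i) \<notin> K"
      using inv_pow[OF k, of i] K_mult_h_pow_in_K_iff[OF k, of "d - i"] i False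
      by (auto dest: dvd_imp_le)
    moreover have "inv (k \<otimes> h [^] i) \<in> A \<longleftrightarrow> e \<le> d - i"
      using A k i False inv_pow[OF k, of i] unfolding odd_pattern_def by simp
    moreover have "e \<le> d - i \<longleftrightarrow> \<not> e \<le> i" using d_eq i by linarith
    ultimately show ?thesis using False k K_carrier h_carrier by simp
  qed
  moreover have "w \<otimes> h \<in> ?B \<longleftrightarrow> w \<in> ?B" if w: "w \<in> carrier G - (K <#> H)" for w
  proof -
    have hH: "h \<in> H" using h_pow_in_H[of 1] h_carrier by simp
    have wh: "w \<otimes> h \<in> carrier G - (K <#> H)"
      using outside_KH_mult_iff[OF _ hH, of w] w h_carrier by simp
    have "inv (w \<otimes> h) \<otimes> h = inv w" using w h_carrier by (simp add: inv_mult m_ac inv_cancel)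
    hence "inv (w \<otimes> h) \<in> A \<longleftrightarrow> inv w \<in> A"
      using odd_pattern_periodic[OF A outside_KH_inv[OF wh] hH] by simp
    thus ?thesis using outside_KH(1)[OF outside_KH_inv[OF wh]] outside_KH(1)[OF outside_KH_inv[OF w]]
        w h_carrier by simp
  qed
  ultimately show ?thesis unfolding odd_pattern_def by blast
qed

lemma odd_pattern_inter_KH:
  assumes "odd_pattern A"
  shows "A \<inter> (K <#> H) = zero_odd_multiples G b d <#> K"
  using assms unfolding odd_pattern_def KH_eq odd_multiples_eq by blast

lemma odd_pattern_mult_iff:
  assumes "odd_pattern A" "v \<in> carrier G - (K <#> H)" "w \<in> H #> v"
  shows "w \<in> A \<longleftrightarrow> v \<in> A"
  using odd_pattern_periodic[OF assms(1,2)] assms(2,3) by (auto simp: mem_H_rcoset)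

lemma ex_pair_structure:
  assumes A: "odd_pattern A" and AG: "A \<subseteq> carrier G"
    and B: "B = {x \<in> carrier G. inv x \<notin> A \<or> inv x \<in> K}"
  shows "\<exists>x k l m. pair_structure G A B b x k l m"
proof -
  let ?W = "carrier G - (K <#> H)" and ?J = "zero_odd_multiples G b d <#> K"
  obtain X where X: "X \<subseteq> ?W" "?W = (\<Union>v\<in>X. sym_coset v)"
    "real (card X) = (real (order G) / real d - real (L_grp G)) / 2"
    "\<And>v. v \<in> X \<Longrightarrow> inv v \<in> A \<Longrightarrow> v \<in> A"
    using ex_representatives[of A] by blast
  have oB: "odd_pattern B" unfolding B by (rule odd_pattern_inv_complement[OF A])
  have finX: "finite X" using X(1) finite_carrier by (meson finite_Diff finite_subset)
  \<comment> \<open>The choice of representatives excludes the case that only the inverse lies in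
    \<open>A\<close>. Elements of \<open>X1\<close> enter \<open>A\<close> and \<open>B\<close> with
    their own sign, those of \<open>X2\<close> enter \<open>A\<close> with both signs, and those of
    \<open>X3\<close> enter \<open>B\<close> with both signs.\<close>
  define X1 where "X1 = {v \<in> X. v \<in> A \<and> inv v \<notin> A}"
  define X2 where "X2 = {v \<in> X. v \<in> A \<and> inv v \<in> A}"
  define X3 where "X3 = {v \<in> X. v \<notin> A \<and> inv v \<notin> A}"
  have XU: "X = X1 \<union> X2 \<union> X3" using X(4) by (auto simp: X1_def X2_def X3_def)
  obtain xs1 where xs1: "set xs1 = X1" "distinct xs1"
    using finite_distinct_list[of X1] finX by (auto simp: X1_def)
  obtain xs2 where xs2: "set xs2 = X2" "distinct xs2"
    using finite_distinct_list[of X2] finX by (auto simp: X2_def)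
  obtain xs3 where xs3: "set xs3 = X3" "distinct xs3"
    using finite_distinct_list[of X3] finX by (auto simp: X3_def)
  define xs where "xs = xs1 @ xs2 @ xs3"
  have dist: "distinct xs" using xs1 xs2 xs3 by (auto simp: xs_def X1_def X2_def X3_def)
  have setxs: "set xs = X" using xs1 xs2 xs3 XU by (auto simp: xs_def)
  \<comment> \<open>The representatives are numbered from 1, list positions from 0.\<close>
  define x where "x i = xs ! (i - 1)" for i
  define k where "k = length xs1"
  define l where "l = k + length xs2"
  define m where "m = length xs"
  have seg: "(\<lambda>i. (ys @ zs @ us) ! (i - 1)) ` {length ys + 1..length ys + length zs} = set zs"
    for ys zs us :: "'a list"
  proof -
    have "i \<in> (\<lambda>j. length ys + 1 + j) ` {..<length zs}"
      if "i \<in> {length ys + 1..length ys + length zs}" for i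
      using that by (intro image_eqI[of _ _ "i - length ys - 1"]) auto
    hence "{length ys + 1..length ys + length zs} = (\<lambda>j. length ys + 1 + j) ` {..<length zs}"
      by auto
    hence "(\<lambda>i. (ys @ zs @ us) ! (i - 1)) ` {length ys + 1..length ys + length zs} =
        (\<lambda>j. zs ! j) ` {..<length zs}"
      by (simp only: image_image) (auto simp: nth_append intro!: image_cong)
    thus ?thesis by (auto simp: set_conv_nth)
  qed
  have x1: "x ` {1..k} = X1"
    using seg[of "[]" xs1 "xs2 @ xs3"] xs1 by (simp add: x_def[abs_def] xs_def k_def)
  have x2: "x ` {k+1..l} = X2"
    using seg[of xs1 xs2 xs3] xs2 by (simp add: x_def[abs_def] xs_def k_def l_def)
  have x3: "x ` {l+1..m} = X3"
    using seg[of "xs1 @ xs2" xs3 "[]"] xs3 by (simp add: x_def[abs_def] xs_def k_def l_def m_def add.assoc)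
  have xm: "x ` {1..m} = X"
    using seg[of "[]" xs "[]"] setxs by (simp add: x_def[abs_def] m_def)
  have klm: "k \<le> l" "l \<le> m" by (auto simp: k_def l_def m_def xs_def)
  have inj: "inj_on x {1..m}"
    using dist by (auto simp: inj_on_def x_def m_def nth_eq_iff_index_eq)
  have cm: "m = card X" using distinct_card[OF dist] setxs by (simp add: m_def)
  have i2: "(\<lambda>i. inv (x i)) ` {k+1..l} = m_inv G ` X2" using x2 by (metis image_image)
  have i3: "(\<lambda>i. inv (x i)) ` {l+1..m} = m_inv G ` X3" using x3 by (metis image_image)
  have XW: "v \<in> ?W" "inv v \<in> ?W" if "v \<in> X" for v using that X(1) outside_KH_inv by blast+
  have cosets: "Y <#> H = (\<Union>v\<in>Y. H #> v)" if "Y \<subseteq> carrier G" for Y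
    using that unfolding set_mult_def by (auto simp: mem_H_rcoset subset_iff) blast
  have sub: "X1 \<subseteq> X" "X2 \<subseteq> X" "X3 \<subseteq> X" using XU by auto
  have Xc: "v \<in> carrier G" if "v \<in> X" for v using that X(1) by blast
  have Biff: "v \<in> B \<longleftrightarrow> inv v \<notin> A" if "v \<in> ?W" for v
    using that outside_KH(1)[OF outside_KH_inv[OF that]] by (auto simp: B)
  \<comment> \<open>Used for \<open>A\<close> with Y = \<open>X2\<close> and for \<open>B\<close>
    with Y = \<open>X3\<close>.\<close>
  have split: "Z \<inter> ?W = (X1 \<union> Y \<union> m_inv G ` Y) <#> H"
    if Z: "odd_pattern Z" and Y: "Y \<subseteq> X" and X1: "\<And>v. v \<in> X1 \<Longrightarrow> v \<in> Z \<and> inv v \<notin> Z"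
      and XZ: "\<And>v. v \<in> X - X1 \<Longrightarrow> v \<in> Z \<or> inv v \<in> Z \<Longrightarrow> v \<in> Y" and YZ: "\<And>v. v \<in> Y \<Longrightarrow> v \<in> Z \<and> inv v \<in> Z"
    for Z Y
  proof -
    have c: "X1 \<union> Y \<union> m_inv G ` Y \<subseteq> carrier G" using sub Y Xc by auto
    show ?thesis unfolding cosets[OF c]
    proof (intro subset_antisym subsetI)
      fix w assume w: "w \<in> Z \<inter> ?W"
      then obtain v where v: "v \<in> X" "w \<in> H #> v \<or> w \<in> H #> inv v"
        using X(2) unfolding sym_coset_def by blast
      show "w \<in> (\<Union>v\<in>X1 \<union> Y \<union> m_inv G ` Y. H #> v)"
        using v(2)
      proof
        assume wv: "w \<in> H #> v"
        hence "v \<in> Z" using w odd_pattern_mult_iff[OF Z XW(1)[OF v(1)]] by blast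
        hence "v \<in> X1 \<union> Y" using XZ v(1) by blast
        thus ?thesis using wv by blast
      next
        assume wv: "w \<in> H #> inv v"
        hence iv: "inv v \<in> Z" using w odd_pattern_mult_iff[OF Z XW(2)[OF v(1)]] by blast
        hence "v \<in> Y" using XZ X1 v(1) by blast
        thus ?thesis using wv by blast
      qed
    next
      fix w assume "w \<in> (\<Union>v\<in>X1 \<union> Y \<union> m_inv G ` Y. H #> v)"
      then obtain u where u: "u \<in> X1 \<union> Y \<union> m_inv G ` Y" "w \<in> H #> u" by blast
      have uZ: "u \<in> Z" using u(1) X1 YZ by blast
      have uW: "u \<in> ?W" using u(1) XW sub Y by blast
      have "w \<in> Z" using odd_pattern_mult_iff[OF Z uW u(2)] uZ by blast
      moreover have "w \<in> ?W" using sym_coset_outside[OF uW] u(2) unfolding sym_coset_def by blast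
      ultimately show "w \<in> Z \<inter> ?W" by blast
    qed
  qed
  have inv2: "inv (inv v) = v" if "v \<in> X" for v using Xc[OF that] by simp
  have AW: "A \<inter> ?W = (X1 \<union> X2 \<union> m_inv G ` X2) <#> H"
    by (rule split[OF A]) (use X(4) in \<open>auto simp: X1_def X2_def\<close>)
  have BW: "B \<inter> ?W = (X1 \<union> X3 \<union> m_inv G ` X3) <#> H"
  proof (rule split[OF oB])
    have *: "v \<in> B \<longleftrightarrow> inv v \<notin> A" "inv v \<in> B \<longleftrightarrow> v \<notin> A" if "v \<in> X" for v
      using Biff[OF XW(1)[OF that]] Biff[OF XW(2)[OF that]] inv2[OF that] by simp_all
    show "v \<in> X1 \<Longrightarrow> v \<in> B \<and> inv v \<notin> B" for v using * by (auto simp: X1_def)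
    show "v \<in> X3 \<Longrightarrow> v \<in> B \<and> inv v \<in> B" for v using * by (auto simp: X3_def)
    show "v \<in> X - X1 \<Longrightarrow> v \<in> B \<or> inv v \<in> B \<Longrightarrow> v \<in> X3" for v
      using * X(4)[of v] by (auto simp: X1_def X3_def)
  qed (use sub in auto)
  have Aeq: "A = ?J \<union> signed_part G H x k k l"
  proof -
    have "A = (A \<inter> (K <#> H)) \<union> (A \<inter> ?W)" using AG by blast
    thus ?thesis unfolding signed_part_def x1 x2 i2 AW[symmetric] odd_pattern_inter_KH[OF A] .
  qed
  have Beq: "B = ?J \<union> signed_part G H x k l m"
  proof -
    have "B = (B \<inter> (K <#> H)) \<union> (B \<inter> ?W)" using B by blast
    thus ?thesis unfolding signed_part_def x1 x3 i3 BW[symmetric] odd_pattern_inter_KH[OF oB] .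
  qed
  have "b \<in> ?J"
  proof -
    have "b = b [^] d \<otimes> h [^] e" "e < d" using b_eq d_eq by (blast, linarith)
    thus ?thesis using b_pow_d_in_K unfolding odd_multiples_eq by blast
  qed
  moreover have "?W = (\<Union>i\<in>{1..m}. (H #> x i) \<union> (H #> inv (x i)))"
    unfolding X(2) xm[symmetric] sym_coset_def by blast
  ultimately have "pair_structure G A B b x k l m"
    unfolding pair_structure_def Let_def card_H
    using Aeq Beq subgroup_H odd_ord ord_gt_1 klm inj X(1,3) cm xm by (auto simp: d_def)
  thus ?thesis by blast
qed

end

text \<open>Along the multiples of h = 2b, membership in \<open>A\<close> is lost from 0 to h
  because b is not in \<open>K\<close>. It must be regained, since the multiples return to 0, and
  that needs some j h + b in \<open>K\<close>. Then (2j + 1) h = 0, so h has odd order.\<close>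

lemma (in comm_group) odd_doubleI:
  assumes fin: "finite (carrier G)" and KA: "K_grp G \<subseteq> A" and sh: "b \<in> shift_set G A (K_grp G)"
    and bK: "b \<notin> K_grp G"
  shows "odd_double G b"
proof -
  define h where "h = b \<otimes> b"
  have b: "b \<in> carrier G" using sh shift_set_carrier by blast
  hence h: "h \<in> carrier G" by (simp add: h_def)
  have "h \<noteq> \<one>" using bK b by (simp add: K_grp_def h_def)
  hence "ord h \<noteq> 1" using ord_eq_1[OF h] by simp
  hence gt: "1 < ord h" using ord_ge_1[OF fin h] by simp
  have oneA: "\<one> \<in> A" "\<one> \<in> K_grp G" using KA by (auto simp: K_grp_def)
  have "\<exists>j::nat. h [^] j \<otimes> b \<in> K_grp G"
  proof (rule ccontr)
    assume neg: "\<not> ?thesis"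
    have "h [^] Suc j \<notin> A" for j
    proof (induction j)
      case 0
      show ?case using shift_setD[OF sh one_closed] oneA bK b h
        by (auto simp: h_def of_bool_def split: if_splits)
    next
      case (Suc j)
      show ?case using shift_setD[OF sh, of "h [^] Suc j"] Suc neg[unfolded not_ex, rule_format, of "Suc j"] h
        by (auto simp: h_def[symmetric] of_bool_def split: if_splits)
    qed
    from this[of "ord h - 1"] show False using gt oneA h by simp
  qed
  then obtain j :: nat where j: "h [^] j \<otimes> b \<in> K_grp G" by blast
  have "h [^] (2 * j + 1) = (h [^] j \<otimes> b) \<otimes> (h [^] j \<otimes> b)"
    using h b by (simp add: h_def nat_pow_distrib mult_2 nat_pow_mult[symmetric] m_ac)
  hence "h [^] (2 * j + 1) = \<one>" using j by (simp add: K_grp_def)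
  hence "ord h dvd 2 * j + 1" using pow_eq_id[OF h] by blast
  hence "odd (ord h)" by (metis dvd_trans even_plus_one_iff even_mult_iff even_numeral)
  thus ?thesis using fin b gt unfolding h_def by unfold_locales auto
qed

text \<open>The last assertions of the theorem concern every admissible b and x, so the pattern must
  be recovered from an arbitrary description of the pair.\<close>

lemma (in comm_group) pair_structureD:
  assumes fin: "finite (carrier G)" and AG: "A \<subseteq> carrier G"
    and ps: "pair_structure G A B b x k l m"
  defines "H \<equiv> generate G {b \<otimes> b}"
  shows "odd_double G b" "odd_double.odd_pattern G b A"
    "signed_part G H x k k l \<subseteq> A - (K_grp G <#> H)" "signed_part G H x k l m \<subseteq> B"
proof -
  have b: "b \<in> carrier G" using ps AG by (auto simp: pair_structure_def Let_def)
  have ord: "ord (b \<otimes> b) = card H" using generate_pow_card[of "b \<otimes> b"] b by (simp add: H_def)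
  show od: "odd_double G b"
    using fin b ps ord unfolding pair_structure_def Let_def H_def by unfold_locales auto
  interpret odd_double G b by (rule od)
  have d: "card H = d" using ord by (simp add: d_def)
  have ps': "k \<le> l" "l \<le> m" "x ` {1..m} \<subseteq> carrier G - (K_grp G <#> H)"
    "A = (zero_odd_multiples G b d <#> K_grp G) \<union> signed_part G H x k k l"
    "B = (zero_odd_multiples G b d <#> K_grp G) \<union> signed_part G H x k l m"
    using ps unfolding pair_structure_def Let_def H_def[symmetric] d by blast+
  have Q: "signed_part G H x k k l \<subseteq> carrier G - (K_grp G <#> H)"
    using signed_part_outside[of x m k l k] ps' unfolding H_def by auto
  thus "signed_part G H x k k l \<subseteq> A - (K_grp G <#> H)" "signed_part G H x k l m \<subseteq> B"
    using ps' by blast+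
  let ?X = "x ` {1..k} \<union> x ` {k+1..l} \<union> (\<lambda>i. inv (x i)) ` {k+1..l}"
  have xc: "x i \<in> carrier G" if "i \<in> {1..m}" for i using that ps'(3) by blast
  have "?X \<subseteq> carrier G" using xc ps'(1,2) by auto
  thus "odd_pattern A"
    using odd_pattern_odd_multiples_Un[of ?X] Q unfolding ps'(4) signed_part_def H_def by blast
qed

section \<open>Passage to the quotient\<close>

locale extremal_quotient = extremal_pair +
  fixes N :: "'a set"
  assumes N_part: "N \<in> parts" and one_N: "\<one> \<in> N"
begin

abbreviation "D \<equiv> sqrt_set \<one> N"

lemma N_carrier: "n \<in> N \<Longrightarrow> n \<in> carrier G" using part_subset[OF N_part] by blast

lemma D_iff: "x \<in> D \<longleftrightarrow> x \<in> carrier G \<and> x \<otimes> x \<in> N"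
  by (auto simp: sqrt_set_def)

text \<open>Some part leaves 0 unrepresented, and by \<open>unrep_part_coset\<close> it is the part
  in the coset 2G, which contains 0.\<close>

lemma one_unrep_N: "\<one> \<in> unrep N"
proof -
  obtain T where T: "T \<in> parts" "\<one> \<in> unrep T"
    using unrep_eq_Union_parts one_unrep one_closed by blast
  obtain y where y: "y \<in> carrier G" "T = S \<inter> (Q #> y)" using partsD[OF T(1)] .
  have "Q #> \<one> = Q #> y" using unrep_part_coset[OF y(1)] T y by blast
  hence "\<one> \<in> T" using y one_S rcos_self[OF one_closed subgroup_doubles] by blast
  thus ?thesis using parts_eqI[OF T(1) N_part _ one_N] T by blast
qed

lemmas unrepresented_part_structure =
  unrepresented_structure[OF finite_carrier AG BG part_subset card_AB_part]

lemma N_doubles: "N \<subseteq> Q"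
  using unrepresented_part_structure(1)[OF N_part N_part one_unrep_N] N_carrier by (metis r_one subsetI)

lemma D_subset_A: "D \<subseteq> A"
  using unrepresented_part_structure(2)[OF N_part N_part one_unrep_N] by blast

lemma card_D: "card D = L_grp G * card N"
  using unrepresented_part_structure(4)[OF N_part N_part one_unrep_N] .

text \<open>The exact count 2|N| of unrepresented elements puts \<open>A\<close> and
  \<open>D\<close> in the extremal case.\<close>

lemma shift_set_D:
  "subgroup D G" "D \<subseteq> shift_set G A D" "\<exists>b. b \<in> shift_set G A D \<and> b \<notin> D"
proof -
  have "card (shift_set G A D) = L_grp G * card (unrep N)"
    using card_shift_set_sqrt_set[OF finite_carrier AG BG part_subset[OF N_part]
        card_AB_part[OF N_part] one_unrep_N part_nonempty[OF N_part]] .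
  hence card: "card (shift_set G A D) = 2 * card D"
    using card_unrep_part[OF N_part] card_D by simp
  have "\<one> \<in> D" using one_N by (simp add: D_iff)
  note ext = shift_set_extremal[OF finite_carrier AG D_subset_A this card]
  show "subgroup D G" "D \<subseteq> shift_set G A D" "\<exists>b. b \<in> shift_set G A D \<and> b \<notin> D"
    using ext by blast+
qed

lemma N_eq_squares: "n \<in> N \<Longrightarrow> \<exists>x\<in>D. n = x \<otimes> x"
  using N_doubles by (force simp: doubles_def D_iff)

text \<open>All elements of \<open>N\<close> are doubles, so \<open>N\<close> is the image of the
  subgroup \<open>D\<close> under doubling.\<close>

lemma subgroup_N: "subgroup N G"
proof (rule subgroupI)
  interpret D: subgroup D G by (rule shift_set_D(1))
  show "N \<subseteq> carrier G" using part_subset[OF N_part] .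
  show "N \<noteq> {}" using one_N by blast
  fix a assume "a \<in> N"
  then obtain x where x: "x \<in> D" "a = x \<otimes> x" using N_eq_squares by blast
  have "inv a = inv x \<otimes> inv x" using x by (simp add: D_iff inv_mult)
  thus "inv a \<in> N" using D.m_inv_closed[OF x(1)] by (simp add: D_iff)
  fix b assume "b \<in> N"
  then obtain y where y: "y \<in> D" "b = y \<otimes> y" using N_eq_squares by blast
  have "x \<in> carrier G" "y \<in> carrier G" using x(1) y(1) by (simp_all add: D_iff)
  hence "a \<otimes> b = (x \<otimes> y) \<otimes> (x \<otimes> y)" unfolding x(2) y(2) by (simp add: m_ac)
  thus "a \<otimes> b \<in> N" using D.m_closed[OF x(1) y(1)] by (simp add: D_iff)
qed

sublocale N: subgroup N G by (rule subgroup_N)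

section \<open>Descent to the quotient by N\<close>

sublocale quot: comm_group "G Mod N" by (rule abelian_FactGroup[OF subgroup_N])

abbreviation proj :: "'a \<Rightarrow> 'a set" where "proj x \<equiv> N #> x"

lemma proj_eq_iff: "x \<in> carrier G \<Longrightarrow> y \<in> carrier G \<Longrightarrow> proj x = proj y \<longleftrightarrow> x \<otimes> inv y \<in> N"
  using N.rcos_module[OF is_group, of y x] repr_independence[OF _ _ subgroup_N, of x y]
    rcos_self[OF _ subgroup_N, of x] by metis

lemma proj_mult: "x \<in> carrier G \<Longrightarrow> y \<in> carrier G \<Longrightarrow> proj (x \<otimes> y) = proj x \<otimes>\<^bsub>G Mod N\<^esub> proj y"
  using normal.rcos_sum[OF subgroup_imp_normal[OF subgroup_N]] by simp

lemma proj_one: "proj \<one> = \<one>\<^bsub>G Mod N\<^esub>"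
  using coset_join2[OF one_closed subgroup_N one_N] by simp

lemma quot_carrier: "carrier (G Mod N) = proj ` carrier G" by (rule carrier_FactGroup)

lemma proj_carrier: "x \<in> carrier G \<Longrightarrow> proj x \<in> carrier (G Mod N)"
  unfolding quot_carrier by blast

lemma proj_inv: "x \<in> carrier G \<Longrightarrow> proj (inv x) = inv\<^bsub>G Mod N\<^esub> proj x"
  by (rule quot.inv_equality[symmetric]) (auto simp: proj_mult[symmetric] proj_one proj_carrier simp del: mult_FactGroup one_FactGroup)

lemma finite_quot: "finite (carrier (G Mod N))"
  unfolding quot_carrier using finite_carrier by simp

text \<open>These are the unions of cosets of \<open>N\<close>, for which membership can be tested
  after projection.\<close>

definition invariant :: "'a set \<Rightarrow> bool"
  where "invariant X \<longleftrightarrow> X \<subseteq> carrier G \<and> (\<forall>w\<in>carrier G. \<forall>n\<in>N. w \<otimes> n \<in> X \<longleftrightarrow> w \<in> X)"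

lemma proj_mem_iff:
  assumes X: "invariant X" and g: "g \<in> carrier G"
  shows "proj g \<in> proj ` X \<longleftrightarrow> g \<in> X"
proof
  assume "proj g \<in> proj ` X"
  then obtain x where x: "x \<in> X" "proj g = proj x" by blast
  have xc: "x \<in> carrier G" using x X by (auto simp: invariant_def)
  have "g \<otimes> inv x \<in> N" using proj_eq_iff[OF g xc] x by simp
  moreover have "g = x \<otimes> (g \<otimes> inv x)" using g xc by (simp add: m_ac inv_cancel)
  ultimately show "g \<in> X" using X x xc unfolding invariant_def by metis
qed blast

lemma invariant_D: "invariant D"
proof -
  have "w \<otimes> n \<in> D \<longleftrightarrow> w \<in> D" if w: "w \<in> carrier G" and n: "n \<in> N" for w n
  proof -
    have nc: "n \<in> carrier G" using N_carrier[OF n] .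
    have "w \<otimes> n \<otimes> (w \<otimes> n) = w \<otimes> w \<otimes> (n \<otimes> n)" using w nc by (simp add: m_ac)
    moreover have "w \<otimes> w \<otimes> (n \<otimes> n) \<in> N \<longleftrightarrow> w \<otimes> w \<in> N"
    proof
      assume "w \<otimes> w \<otimes> (n \<otimes> n) \<in> N"
      hence "w \<otimes> w \<otimes> (n \<otimes> n) \<otimes> inv (n \<otimes> n) \<in> N" using n by simp
      thus "w \<otimes> w \<in> N" using w nc by (simp add: m_assoc)
    qed (use n in simp)
    ultimately show ?thesis using w nc by (simp add: D_iff)
  qed
  thus ?thesis by (auto simp: invariant_def D_iff)
qed

text \<open>An element of \<open>N\<close> is 2x with x in \<open>D\<close>. This x is a shift, and
  the right side of its identity vanishes because \<open>D\<close> is a subgroup.\<close>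

lemma invariant_A: "invariant A"
proof -
  have "w \<otimes> n \<in> A \<longleftrightarrow> w \<in> A" if w: "w \<in> carrier G" and n: "n \<in> N" for w n
  proof -
    obtain x where x: "x \<in> D" "n = x \<otimes> x" using N_eq_squares[OF n] by blast
    interpret D: subgroup D G by (rule shift_set_D(1))
    have xc: "x \<in> carrier G" using x by (simp add: D_iff)
    have "w = w \<otimes> x \<otimes> inv x" using w xc by (simp add: m_assoc)
    hence "w \<otimes> x \<in> D \<longleftrightarrow> w \<in> D" using x D.m_closed D.m_inv_closed by metis
    moreover have "x \<in> shift_set G A D" using x shift_set_D(2) by blast
    ultimately show ?thesis
      using shift_setD[of x A D w] w x(2) by (auto simp: of_bool_def split: if_splits)
  qed
  thus ?thesis using AG by (simp add: invariant_def)
qed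

lemma B_iff: "x \<in> carrier G \<Longrightarrow> x \<in> B \<longleftrightarrow> inv x \<notin> A \<or> inv x \<in> D"
  using unrepresented_part_structure(3)[OF N_part N_part one_unrep_N, of "inv x"] by simp

lemma K_quot: "K_grp (G Mod N) = proj ` D"
proof -
  have "proj x \<otimes>\<^bsub>G Mod N\<^esub> proj x = \<one>\<^bsub>G Mod N\<^esub> \<longleftrightarrow> x \<in> D" if x: "x \<in> carrier G" for x
  proof -
    have "proj x \<otimes>\<^bsub>G Mod N\<^esub> proj x = \<one>\<^bsub>G Mod N\<^esub> \<longleftrightarrow> proj (x \<otimes> x) = proj \<one>"
      unfolding proj_one proj_mult[OF x x] ..
    thus ?thesis using proj_eq_iff[of "x \<otimes> x" \<one>] x by (simp add: D_iff)
  qed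
  moreover have "D \<subseteq> carrier G" by (auto simp: D_iff)
  ultimately show ?thesis unfolding K_grp_def quot_carrier by blast
qed

lemma proj_in_K_iff: "x \<in> carrier G \<Longrightarrow> proj x \<in> K_grp (G Mod N) \<longleftrightarrow> x \<in> D"
  unfolding K_quot by (rule proj_mem_iff[OF invariant_D])

lemma proj_B: "proj ` B = {X \<in> carrier (G Mod N).
    inv\<^bsub>G Mod N\<^esub> X \<notin> proj ` A \<or> inv\<^bsub>G Mod N\<^esub> X \<in> K_grp (G Mod N)}"
proof -
  have *: "inv\<^bsub>G Mod N\<^esub> proj x \<notin> proj ` A \<or> inv\<^bsub>G Mod N\<^esub> proj x \<in> K_grp (G Mod N) \<longleftrightarrow> x \<in> B"
    if x: "x \<in> carrier G" for x
    unfolding proj_inv[OF x, symmetric] B_iff[OF x]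
    using proj_mem_iff[OF invariant_A] proj_in_K_iff x by simp
  show ?thesis
  proof (intro subset_antisym subsetI)
    fix X assume "X \<in> proj ` B"
    then obtain x where x: "x \<in> B" "X = proj x" by blast
    thus "X \<in> {X \<in> carrier (G Mod N). inv\<^bsub>G Mod N\<^esub> X \<notin> proj ` A \<or> inv\<^bsub>G Mod N\<^esub> X \<in> K_grp (G Mod N)}"
      using * BG proj_carrier by blast
  next
    fix X assume "X \<in> {X \<in> carrier (G Mod N). inv\<^bsub>G Mod N\<^esub> X \<notin> proj ` A \<or> inv\<^bsub>G Mod N\<^esub> X \<in> K_grp (G Mod N)}"
    thus "X \<in> proj ` B" unfolding quot_carrier using * by blast
  qed
qed

lemma proj_shift_set_iff:
  assumes u: "u \<in> carrier G"
  shows "proj u \<in> shift_set (G Mod N) (proj ` A) (K_grp (G Mod N)) \<longleftrightarrow> u \<in> shift_set G A D"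
proof -
  show ?thesis
    unfolding shift_set_def quot_carrier using u
    by (simp add: proj_mult[symmetric] proj_mem_iff[OF invariant_A] proj_in_K_iff del: mult_FactGroup)
qed

lemma K_quot_subset: "K_grp (G Mod N) \<subseteq> proj ` A"
  unfolding K_quot using D_subset_A by blast

text \<open>A shift outside \<open>D\<close> projects to a shift outside the kernel of doubling in
  the quotient; its class is the required b.\<close>

lemma ex_quot_pair_structure: "\<exists>b x k l m. pair_structure (G Mod N) (proj ` A) (proj ` B) b x k l m"
proof -
  obtain b where b: "b \<in> shift_set G A D" "b \<notin> D" using shift_set_D(3) by blast
  have bc: "b \<in> carrier G" using b shift_set_carrier by blast
  have sh: "proj b \<in> shift_set (G Mod N) (proj ` A) (K_grp (G Mod N))"
    using proj_shift_set_iff[OF bc] b by simp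
  have "proj b \<notin> K_grp (G Mod N)" using proj_in_K_iff[OF bc] b by simp
  then interpret odd_double "G Mod N" "proj b"
    using quot.odd_doubleI[OF finite_quot K_quot_subset sh] by blast
  have "proj ` A \<subseteq> carrier (G Mod N)" using AG proj_carrier by blast
  from ex_pair_structure[OF shift_set_imp_odd_pattern[OF K_quot_subset sh] this proj_B]
  show ?thesis by blast
qed

lemma card_invariant:
  assumes X: "invariant X"
  shows "card X = card N * card (proj ` X)"
proof -
  have Xc: "X \<subseteq> carrier G" using X by (simp add: invariant_def)
  have "X = \<Union>(proj ` X)"
  proof
    show "X \<subseteq> \<Union>(proj ` X)" using Xc rcos_self[OF _ subgroup_N] by blast
    show "\<Union>(proj ` X) \<subseteq> X"
    proof
      fix g assume "g \<in> \<Union>(proj ` X)"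
      then obtain x where x: "x \<in> X" "g \<in> proj x" by blast
      hence "proj x = proj g" using repr_independence[OF x(2) _ subgroup_N] Xc by blast
      moreover have "g \<in> carrier G" using x Xc N_carrier by (auto simp: r_coset_def)
      ultimately show "g \<in> X" using proj_mem_iff[OF X] x by blast
    qed
  qed
  moreover have "card (\<Union>(proj ` X)) = (\<Sum>c\<in>proj ` X. card c)"
  proof (rule card_Union_disjoint)
    show "disjoint (proj ` X)"
    proof (rule pairwiseI)
      fix c c' assume cc: "c \<in> proj ` X" "c' \<in> proj ` X" "c \<noteq> c'"
      have "c = c'" if "g \<in> c" "g \<in> c'" for g
        using that cc(1,2) Xc repr_independence[OF _ _ subgroup_N] by blast
      thus "disjnt c c'" using cc(3) by (auto simp: disjnt_def)
    qed
    show "finite c" if "c \<in> proj ` X" for c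
      using that finite_subset[OF N.subset finite_carrier] by (auto simp: r_coset_def)
  qed
  moreover have "card c = card N" if "c \<in> proj ` X" for c
    using that Xc card_rcosets_equal[OF rcosetsI[OF N.subset] N.subset] by auto
  ultimately show ?thesis by simp
qed

section \<open>The remaining parts of S and the exceptions\<close>

context
  fixes b :: "'a set" and x :: "nat \<Rightarrow> 'a set" and k l m :: nat and c :: 'a
  assumes ps: "pair_structure (G Mod N) (proj ` A) (proj ` B) b x k l m"
    and c: "c \<in> carrier G" "proj c = b"
begin

text \<open>\<open>B\<close> is determined by \<open>A\<close> and \<open>D\<close> through the
  unrepresented element 0, and by \<open>A\<close> and \<open>sqrt_set z T\<close> through z.
  Comparison shows that \<open>A\<close> without \<open>sqrt_set z T\<close> is the translate by z
  of A - D, and \<open>translate_rigid\<close> in the quotient leaves two cases.\<close>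

lemma unrep_part_coset_structure:
  assumes T: "T \<in> parts" and z: "z \<in> unrep T"
  shows "\<exists>y\<in>D. T = proj y \<and> (z = y \<or> z = y \<otimes> (c \<otimes> c))"
    and "proj ` sqrt_set z T \<subseteq> K_grp (G Mod N) <#>\<^bsub>G Mod N\<^esub> generate (G Mod N) {b \<otimes>\<^bsub>G Mod N\<^esub> b}"
proof -
  let ?\<Gamma> = "G Mod N" and ?E = "sqrt_set z T"
  note str = unrepresented_part_structure[OF T T z]
  have zc: "z \<in> carrier G" using z by blast
  have AG': "proj ` A \<subseteq> carrier ?\<Gamma>" using AG proj_carrier by blast
  note psD = quot.pair_structureD[OF finite_quot AG' ps]
  interpret od: odd_double ?\<Gamma> b by (rule psD(1))
  have EA: "?E \<subseteq> A" using str(2) by blast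
  have Ec: "?E \<subseteq> carrier G" using EA AG by blast
  have shift: "y \<in> A - ?E \<longleftrightarrow> y \<otimes> inv z \<in> A - D" if y: "y \<in> carrier G" for y
  proof -
    have "inv (inv y \<otimes> z) = y \<otimes> inv z" using y zc by (simp add: inv_mult)
    thus ?thesis using str(3)[OF y] B_iff[of "inv y \<otimes> z"] y zc by auto
  qed
  have invA: "w \<otimes> n \<in> A \<longleftrightarrow> w \<in> A" and invD: "w \<otimes> n \<in> D \<longleftrightarrow> w \<in> D"
    if "w \<in> carrier G" "n \<in> N" for w n
    using invariant_A invariant_D that unfolding invariant_def by blast+
  \<comment> \<open>Inherited from \<open>A\<close> and A - D, since A - E is a translate of the
    latter and E is contained in \<open>A\<close>.\<close>
  have invE: "invariant ?E"
  proof -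
    have "w \<otimes> n \<in> ?E \<longleftrightarrow> w \<in> ?E" if w: "w \<in> carrier G" and n: "n \<in> N" for w n
    proof -
      have "w \<otimes> n \<otimes> inv z = w \<otimes> inv z \<otimes> n" using w zc N_carrier[OF n] by (simp add: m_ac)
      thus ?thesis
        using shift[of w] shift[of "w \<otimes> n"] invA[OF w n] invA[OF _ n, of "w \<otimes> inv z"]
          invD[OF _ n, of "w \<otimes> inv z"] w zc N_carrier[OF n] EA by auto
    qed
    thus ?thesis using Ec by (simp add: invariant_def)
  qed
  have cardN: "card N > 0" using one_N finite_subset[OF N.subset finite_carrier] by (metis card_gt_0_iff empty_iff)
  have "card ?E = card D" using str(4) card_D card_part[OF T] card_part[OF N_part] by simp
  hence cardE: "card (proj ` ?E) = card (K_grp ?\<Gamma>)"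
    using card_invariant[OF invE] card_invariant[OF invariant_D] cardN unfolding K_quot by simp
  have main: "(proj z \<in> K_grp ?\<Gamma> \<and> proj ` ?E = K_grp ?\<Gamma>) \<or>
    ((\<exists>y\<in>K_grp ?\<Gamma>. proj z = y \<otimes>\<^bsub>?\<Gamma>\<^esub> od.h) \<and> proj ` ?E = (\<lambda>y. y \<otimes>\<^bsub>?\<Gamma>\<^esub> b) ` K_grp ?\<Gamma>)"
  proof (rule od.translate_rigid[OF psD(2) _ cardE])
    show "proj ` ?E \<subseteq> proj ` A" using EA by blast
    show "finite (proj ` ?E)" using Ec finite_carrier finite_subset by blast
    show "proj z \<in> carrier ?\<Gamma>" using zc proj_carrier by blast
    fix W assume "W \<in> carrier ?\<Gamma>"
    then obtain w where w: "w \<in> carrier G" "W = proj w" unfolding quot_carrier by blast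
    have "w \<otimes> z \<otimes> inv z = w" using w zc by (simp add: m_assoc)
    hence "w \<otimes> z \<in> A - ?E \<longleftrightarrow> w \<in> A - D" using shift[of "w \<otimes> z"] w zc by simp
    thus "W \<otimes>\<^bsub>?\<Gamma>\<^esub> proj z \<in> proj ` A - proj ` ?E \<longleftrightarrow> W \<in> proj ` A - K_grp ?\<Gamma>"
      unfolding w(2) proj_mult[OF w(1) zc, symmetric]
      using w zc proj_mem_iff[OF invariant_A] proj_mem_iff[OF invE] proj_in_K_iff by simp
  qed
  \<comment> \<open>Each t in \<open>T\<close> is 2a - z for some a in E, because t + z is a double.
    The condition \<open>sq\<close> puts t + y into \<open>N\<close>, and 2y is in \<open>N\<close>,
    so t lies in y + N; equal sizes finish.\<close>
  have T_eq: "T = proj y" if y: "y \<in> D" and sq: "\<And>a. a \<in> ?E \<Longrightarrow> a \<otimes> a \<otimes> inv z \<otimes> y \<in> N" for y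
  proof -
    have yc: "y \<in> carrier G" "y \<otimes> y \<in> N" using y by (auto simp: D_iff)
    have "T \<subseteq> proj y"
    proof
      fix t assume t: "t \<in> T"
      have tc: "t \<in> carrier G" using t part_subset[OF T] by blast
      obtain a where a: "a \<in> carrier G" "t \<otimes> z = a \<otimes> a" using str(1)[OF t] by (auto simp: doubles_def)
      have at: "a \<otimes> a \<otimes> inv z = t" unfolding a(2)[symmetric] using tc zc by (simp add: m_assoc)
      hence "a \<in> ?E" using a t by (simp add: sqrt_set_def)
      hence ty: "t \<otimes> y \<in> N" using sq at by metis
      have "t \<otimes> y \<otimes> inv (y \<otimes> y) = t \<otimes> inv y" using tc yc(1) by (simp add: inv_mult m_ac inv_cancel inv_cancel2)
      hence "t \<otimes> inv y \<in> N" using ty yc(2) by (metis N.m_closed N.m_inv_closed)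
      thus "t \<in> proj y" using N.rcos_module[OF is_group yc(1) tc] by blast
    qed
    moreover have "finite (proj y)"
      using finite_subset[OF N.subset finite_carrier] by (simp add: r_coset_def)
    moreover have "card T = card (proj y)"
    proof -
      have "card (proj y) = card N" using card_rcosets_equal[OF rcosetsI[OF N.subset yc(1)] N.subset] by simp
      moreover have "card T = card N" using card_part[OF T] card_part[OF N_part] L_grp_pos[OF finite_carrier]
        by (metis mult_left_cancel not_gr0)
      ultimately show ?thesis by simp
    qed
    ultimately show ?thesis using card_subset_eq by blast
  qed
  have KKH: "K_grp ?\<Gamma> \<subseteq> K_grp ?\<Gamma> <#>\<^bsub>?\<Gamma>\<^esub> generate ?\<Gamma> {b \<otimes>\<^bsub>?\<Gamma>\<^esub> b}"
    using od.outside_KH(1) od.K_carrier by blast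
  have "(\<exists>y\<in>D. T = proj y \<and> (z = y \<or> z = y \<otimes> (c \<otimes> c))) \<and>
    proj ` ?E \<subseteq> K_grp ?\<Gamma> <#>\<^bsub>?\<Gamma>\<^esub> generate ?\<Gamma> {b \<otimes>\<^bsub>?\<Gamma>\<^esub> b}"
    using main
  proof
    assume a: "proj z \<in> K_grp ?\<Gamma> \<and> proj ` ?E = K_grp ?\<Gamma>"
    have zD: "z \<in> D" using a proj_in_K_iff[OF zc] by blast
    have "a' \<otimes> a' \<otimes> inv z \<otimes> z \<in> N" if "a' \<in> ?E" for a'
    proof -
      have "a' \<in> D" using a that proj_in_K_iff[of a'] Ec by blast
      thus ?thesis using zc by (simp add: D_iff m_assoc)
    qed
    hence "T = proj z" using T_eq[OF zD] by blast
    thus ?thesis using zD a KKH by blast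
  next
    assume a: "(\<exists>y\<in>K_grp ?\<Gamma>. proj z = y \<otimes>\<^bsub>?\<Gamma>\<^esub> od.h) \<and> proj ` ?E = (\<lambda>y. y \<otimes>\<^bsub>?\<Gamma>\<^esub> b) ` K_grp ?\<Gamma>"
    have h: "od.h = proj (c \<otimes> c)" unfolding od.h_def using c proj_mult by blast
    obtain y' where y': "y' \<in> D" "proj z = proj y' \<otimes>\<^bsub>?\<Gamma>\<^esub> proj (c \<otimes> c)"
      using a unfolding K_quot h by blast
    have y'c: "y' \<in> carrier G" using y' by (simp add: D_iff)
    \<comment> \<open>Subtracting 2c in G itself, not just modulo \<open>N\<close>, makes z = y + 2c
      exact.\<close>
    define y where "y = z \<otimes> inv (c \<otimes> c)"
    have yc: "y \<in> carrier G" using zc c by (simp add: y_def)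
    have zy: "z = y \<otimes> (c \<otimes> c)" using zc c by (simp add: y_def m_assoc)
    have "proj z = proj (y' \<otimes> (c \<otimes> c))" using y'(2) y'c c proj_mult by simp
    hence "z \<otimes> inv (y' \<otimes> (c \<otimes> c)) \<in> N" using proj_eq_iff zc y'c c by simp
    moreover have "z \<otimes> inv (y' \<otimes> (c \<otimes> c)) = y \<otimes> inv y'"
      using zc y'c c by (simp add: y_def inv_mult m_ac)
    ultimately have "proj y = proj y'" using proj_eq_iff yc y'c by simp
    hence yD: "y \<in> D" using y'(1) proj_mem_iff[OF invariant_D yc] by blast
    \<comment> \<open>Modulo \<open>N\<close> the set E is D + c in this case, and 2a' - z + y =
      2(a' - c).\<close>
    have "a' \<otimes> a' \<otimes> inv z \<otimes> y \<in> N" if a': "a' \<in> ?E" for a'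
    proof -
      have a'c: "a' \<in> carrier G" using a' Ec by blast
      obtain y1 where y1: "y1 \<in> D" "proj a' = proj y1 \<otimes>\<^bsub>?\<Gamma>\<^esub> proj c"
        using a a' unfolding K_quot c(2)[symmetric] by blast
      have y1c: "y1 \<in> carrier G" using y1 by (simp add: D_iff)
      have "proj a' = proj (y1 \<otimes> c)" using y1(2) proj_mult[OF y1c c(1)] by simp
      hence "a' \<otimes> inv (y1 \<otimes> c) \<in> N" using proj_eq_iff[of a' "y1 \<otimes> c"] a'c y1c c by simp
      moreover have "a' \<otimes> inv (y1 \<otimes> c) = a' \<otimes> inv c \<otimes> inv y1"
        using a'c y1c c by (simp add: inv_mult m_ac)
      ultimately have "proj (a' \<otimes> inv c) = proj y1" using proj_eq_iff a'c y1c c by simp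
      hence "a' \<otimes> inv c \<in> D" using y1(1) proj_mem_iff[OF invariant_D, of "a' \<otimes> inv c"] a'c c by simp
      hence "a' \<otimes> inv c \<otimes> (a' \<otimes> inv c) \<in> N" by (simp add: D_iff)
      moreover have "a' \<otimes> inv c \<otimes> (a' \<otimes> inv c) = a' \<otimes> a' \<otimes> inv z \<otimes> y"
        using a'c yc c unfolding zy by (simp add: inv_mult m_ac inv_cancel inv_cancel2)
      ultimately show ?thesis by simp
    qed
    hence "T = proj y" using T_eq[OF yD] by blast
    moreover have "proj ` ?E \<subseteq> K_grp ?\<Gamma> <#>\<^bsub>?\<Gamma>\<^esub> generate ?\<Gamma> {b \<otimes>\<^bsub>?\<Gamma>\<^esub> b}"
    proof
      fix W assume "W \<in> proj ` ?E"
      then obtain v where v: "v \<in> K_grp ?\<Gamma>" "W = v \<otimes>\<^bsub>?\<Gamma>\<^esub> b" using a by blast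
      show "W \<in> K_grp ?\<Gamma> <#>\<^bsub>?\<Gamma>\<^esub> generate ?\<Gamma> {b \<otimes>\<^bsub>?\<Gamma>\<^esub> b}" unfolding v(2)
        by (rule subgroup.m_closed[OF od.subgroup_KH subsetD[OF KKH v(1)] od.b_in_KH])
    qed
    ultimately show ?thesis using yD zy by blast
  qed
  thus "\<exists>y\<in>D. T = proj y \<and> (z = y \<or> z = y \<otimes> (c \<otimes> c))"
    and "proj ` ?E \<subseteq> K_grp ?\<Gamma> <#>\<^bsub>?\<Gamma>\<^esub> generate ?\<Gamma> {b \<otimes>\<^bsub>?\<Gamma>\<^esub> b}" by blast+
qed

lemma parts_cosets: "T \<in> parts \<Longrightarrow> T \<in> proj ` D"
proof -
  assume T: "T \<in> parts"
  have "card T > 0"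
    using part_nonempty[OF T] part_subset[OF T] finite_carrier by (meson card_gt_0_iff finite_subset)
  hence "unrep T \<noteq> {}" using card_unrep_part[OF T] by (metis card.empty mult_is_0 not_gr0 zero_neq_numeral)
  then obtain z where "z \<in> unrep T" by blast
  from unrep_part_coset_structure(1)[OF T this] show "T \<in> proj ` D" by blast
qed

lemma doubles_S: "doubles G S \<subseteq> N"
proof
  fix w assume "w \<in> doubles G S"
  then obtain s where s: "s \<in> S" "w = s \<otimes> s" by (auto simp: doubles_def)
  have sc: "s \<in> carrier G" using s SG by blast
  have "s \<in> S \<inter> (Q #> s)" using s rcos_self[OF sc subgroup_doubles] by blast
  hence "S \<inter> (Q #> s) \<in> parts" using coset_part_in_parts[OF sc] by blast
  then obtain y where y: "y \<in> D" "s \<in> proj y"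
    using parts_cosets \<open>s \<in> S \<inter> (Q #> s)\<close> by blast
  have "proj s = proj y" using repr_independence[OF y(2) _ subgroup_N] y(1) by (simp add: D_iff)
  hence "s \<in> D" using proj_mem_iff[OF invariant_D sc] y by blast
  thus "w \<in> N" using s by (simp add: D_iff)
qed

text \<open>Each unrepresented z is y or y + 2c with y in some part of \<open>S\<close>. As the
  right side has at most 2|S| elements, counting turns this inclusion into equality.\<close>

lemma unrep_S: "unrep S = {\<one>, c \<otimes> c} <#> S"
proof (rule card_seteq)
  have eq: "{\<one>, c \<otimes> c} <#> S = S \<union> (\<lambda>s. c \<otimes> c \<otimes> s) ` S"
    using SG by (auto simp: set_mult_def subset_iff)
  have finS: "finite S" using finite_subset[OF SG finite_carrier] .
  show "finite ({\<one>, c \<otimes> c} <#> S)" unfolding eq using finS by simp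
  show "unrep S \<subseteq> {\<one>, c \<otimes> c} <#> S"
  proof
    fix z assume "z \<in> unrep S"
    then obtain T where T: "T \<in> parts" "z \<in> unrep T" using unrep_eq_Union_parts by blast
    then obtain y where y: "y \<in> D" "T = proj y" "z = y \<or> z = y \<otimes> (c \<otimes> c)"
      using unrep_part_coset_structure(1) by blast
    have yc: "y \<in> carrier G" using y by (simp add: D_iff)
    have "y \<in> T" using y rcos_self[OF yc subgroup_N] by simp
    moreover have "T \<subseteq> S" using T by (auto elim: partsD)
    ultimately have "y \<in> S" by blast
    moreover have "y \<otimes> (c \<otimes> c) = c \<otimes> c \<otimes> y" using yc c by (simp add: m_comm)
    ultimately show "z \<in> {\<one>, c \<otimes> c} <#> S" unfolding eq using y(3) by auto
  qed
  have "card ({\<one>, c \<otimes> c} <#> S) \<le> card S + card S"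
    unfolding eq using card_Un_le[of S "(\<lambda>s. c \<otimes> c \<otimes> s) ` S"] card_image_le[OF finS, of "\<lambda>s. c \<otimes> c \<otimes> s"]
    by linarith
  thus "card ({\<one>, c \<otimes> c} <#> S) \<le> card (unrep S)" using card_unrep by simp
qed

text \<open>A decomposition of the class of z as q + r would lift, by invariance of
  \<open>A\<close>, to a representation of z whose first summand lies over q. But all first summands
  lie over K + H, and q does not.\<close>

lemma unrep_notin_signed_sumset:
  assumes z: "z \<in> unrep S"
  defines "H \<equiv> generate (G Mod N) {b \<otimes>\<^bsub>G Mod N\<^esub> b}"
  shows "proj z \<notin> signed_part (G Mod N) H x k k l <#>\<^bsub>G Mod N\<^esub> signed_part (G Mod N) H x k l m"
proof
  assume "proj z \<in> signed_part (G Mod N) H x k k l <#>\<^bsub>G Mod N\<^esub> signed_part (G Mod N) H x k l m"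
  then obtain q r where qr: "q \<in> signed_part (G Mod N) H x k k l" "r \<in> signed_part (G Mod N) H x k l m"
    "proj z = q \<otimes>\<^bsub>G Mod N\<^esub> r" unfolding set_mult_def[of "G Mod N"] by blast
  have AG': "proj ` A \<subseteq> carrier (G Mod N)" using AG proj_carrier by blast
  note psD = quot.pair_structureD[OF finite_quot AG' ps]
  have q: "q \<in> proj ` A" "q \<notin> K_grp (G Mod N) <#>\<^bsub>G Mod N\<^esub> H"
    using qr(1) psD(3) unfolding H_def by blast+
  have "r \<in> proj ` B" using qr(2) psD(4) unfolding H_def by blast
  then obtain a' b' where ab: "a' \<in> A" "q = proj a'" "b' \<in> B" "r = proj b'" using q by blast
  have abc: "a' \<in> carrier G" "b' \<in> carrier G" "z \<in> carrier G" using ab AG BG z by blast+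
  define a where "a = z \<otimes> inv b'"
  have ac: "a \<in> carrier G" using abc by (simp add: a_def)
  have "proj z = proj (a' \<otimes> b')" using qr(3) ab abc proj_mult by simp
  hence "z \<otimes> inv (a' \<otimes> b') \<in> N" using proj_eq_iff abc by simp
  moreover have "z \<otimes> inv (a' \<otimes> b') = a \<otimes> inv a'" using abc by (simp add: a_def inv_mult m_ac)
  ultimately have pa: "proj a = proj a'" using proj_eq_iff ac abc by simp
  hence aA: "a \<in> A" using proj_mem_iff[OF invariant_A ac] ab by blast
  have "inv a \<otimes> z = b'" using abc by (simp add: a_def inv_mult m_ac inv_cancel inv_cancel2)
  hence rep: "a \<in> {a \<in> A. inv a \<otimes> z \<in> B}" using aA ab by simp
  obtain T where T: "T \<in> parts" "z \<in> unrep T" using z unrep_eq_Union_parts by blast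
  have "a \<in> sqrt_set z T" using rep unrepresented_part_structure(2)[OF T(1) T(1) T(2)] by blast
  hence "proj a \<in> K_grp (G Mod N) <#>\<^bsub>G Mod N\<^esub> H"
    using unrep_part_coset_structure(2)[OF T] unfolding H_def by blast
  thus False using q(2) ab pa by simp
qed

end

text \<open>The cosets of \<open>N\<close> in \<open>D\<close> are numbered with the parts of
  \<open>S\<close> first and the remaining cosets after them.\<close>

lemma ex_coset_numbering:
  fixes P :: "nat \<Rightarrow> 'a set"
  assumes P: "bij_betw P {1..t} parts"
    and ps: "pair_structure (G Mod N) (proj ` A) (proj ` B) b x k l m"
  shows "\<exists>r y. r \<ge> t \<and> y ` {1..r} \<subseteq> carrier G \<and>
    inj_on (\<lambda>i. N #> y i) {1..r} \<and>
    {g \<in> carrier G. g \<otimes> g \<in> N} = (\<Union>i\<in>{1..r}. N #> y i) \<and>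
    (\<forall>i\<in>{1..t}. P i = N #> y i) \<and>
    doubles G S \<subseteq> N \<and>
    (\<forall>c\<in>carrier G. N #> c = b \<longrightarrow> unrep S = {\<one>, c \<otimes> c} <#> S) \<and>
    ({\<one>\<^bsub>G Mod N\<^esub>, b \<otimes>\<^bsub>G Mod N\<^esub> b} <#>\<^bsub>G Mod N\<^esub> ((\<lambda>g. N #> g) ` y ` {1..t})) \<inter>
      (signed_part (G Mod N) (generate (G Mod N) {b \<otimes>\<^bsub>G Mod N\<^esub> b}) x k k l <#>\<^bsub>G Mod N\<^esub>
       signed_part (G Mod N) (generate (G Mod N) {b \<otimes>\<^bsub>G Mod N\<^esub> b}) x k l m) = {}"
proof -
  have Pi: "P i \<in> parts" if "i \<in> {1..t}" for i using P that by (auto simp: bij_betw_def)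
  have Pinj: "inj_on P {1..t}" and Pimg: "P ` {1..t} = parts" using P by (auto simp: bij_betw_def)
  have Dset: "{g \<in> carrier G. g \<otimes> g \<in> N} = D" using D_iff by blast
  have "b \<in> proj ` A" using ps by (auto simp: pair_structure_def Let_def)
  then obtain c where c: "c \<in> carrier G" "proj c = b" using AG by blast
  define C where "C = proj ` D - P ` {1..t}"
  have PD: "P ` {1..t} \<subseteq> proj ` D" using parts_cosets[OF ps c] Pimg by blast
  have DG: "D \<subseteq> carrier G" by (auto simp: D_iff)
  have "finite C" using finite_subset[OF DG finite_carrier] by (simp add: C_def)
  then obtain f where f: "bij_betw f {1..card C} C" using ex_bij_betw_nat_finite_1 by blast
  define r where "r = t + card C"
  define F where "F i = (if i \<le> t then P i else f (i - t))" for i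
  have Ft: "F i = P i" if "i \<in> {1..t}" for i using that by (simp add: F_def)
  have Fu: "F i = f (i - t)" "i - t \<in> {1..card C}" if "i \<in> {t+1..r}" for i
    using that by (auto simp: F_def r_def)
  have split: "{1..r} = {1..t} \<union> {t+1..r}" by (auto simp: r_def)
  have bt: "bij_betw F {1..t} (P ` {1..t})"
    using Pinj Ft by (metis bij_betw_cong bij_betw_imageI)
  have "bij_betw (\<lambda>i. i - t) {t+1..r} {1..card C}"
    by (rule bij_betwI[where g = "\<lambda>j. j + t"]) (auto simp: r_def)
  from bij_betw_trans[OF this f] have "bij_betw F {t+1..r} C"
    using Fu(1) by (subst bij_betw_cong[of _ F "f \<circ> (\<lambda>i. i - t)"]) auto
  from bij_betw_combine[OF bt this] have bF: "bij_betw F {1..r} (proj ` D)"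
    unfolding split using PD by (simp add: C_def Un_absorb1)
  hence "F i \<in> proj ` D" if "i \<in> {1..r}" for i using that by (rule bij_betw_apply)
  hence "\<forall>i\<in>{1..r}. \<exists>y\<in>D. F i = proj y" by blast
  then obtain y where y: "\<And>i. i \<in> {1..r} \<Longrightarrow> y i \<in> D" "\<And>i. i \<in> {1..r} \<Longrightarrow> F i = proj (y i)" by metis
  have tr: "t \<le> r" by (simp add: r_def)
  have yc: "y ` {1..r} \<subseteq> carrier G" using y(1) DG by blast
  have "inj_on (\<lambda>i. proj (y i)) {1..r} \<longleftrightarrow> inj_on F {1..r}" using y(2) by (intro inj_on_cong) simp
  hence inj: "inj_on (\<lambda>i. proj (y i)) {1..r}" using bF by (simp add: bij_betw_def)
  have "(\<Union>i\<in>{1..r}. proj (y i)) = (\<Union>i\<in>{1..r}. F i)" using y(2) by simp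
  also have "\<dots> = \<Union>(proj ` D)" using bF by (simp add: bij_betw_def)
  also have "\<dots> = D"
  proof
    show "D \<subseteq> \<Union>(proj ` D)" using DG rcos_self[OF _ subgroup_N] by blast
    show "\<Union>(proj ` D) \<subseteq> D"
    proof
      fix g assume "g \<in> \<Union>(proj ` D)"
      then obtain v where v: "v \<in> D" "g \<in> proj v" by blast
      hence "proj v = proj g" using repr_independence[OF v(2) _ subgroup_N] DG by blast
      moreover have "g \<in> carrier G" using v DG N_carrier by (auto simp: r_coset_def)
      ultimately show "g \<in> D" using proj_mem_iff[OF invariant_D] v by blast
    qed
  qed
  finally have Deq: "{g \<in> carrier G. g \<otimes> g \<in> N} = (\<Union>i\<in>{1..r}. proj (y i))" using Dset by simp
  have Py: "P i = proj (y i)" if "i \<in> {1..t}" for i using y(2)[of i] Ft[OF that] that tr by auto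
  have exc_eq: "unrep S = {\<one>, c' \<otimes> c'} <#> S" if "c' \<in> carrier G" "proj c' = b" for c'
    using unrep_S[OF ps that] .
  \<comment> \<open>Such W is the class of an element of {0, 2c} + S, hence of an unrepresented
    element.\<close>
  have "W \<notin> signed_part (G Mod N) (generate (G Mod N) {b \<otimes>\<^bsub>G Mod N\<^esub> b}) x k k l <#>\<^bsub>G Mod N\<^esub>
       signed_part (G Mod N) (generate (G Mod N) {b \<otimes>\<^bsub>G Mod N\<^esub> b}) x k l m"
    if W: "W \<in> {\<one>\<^bsub>G Mod N\<^esub>, b \<otimes>\<^bsub>G Mod N\<^esub> b} <#>\<^bsub>G Mod N\<^esub> (proj ` y ` {1..t})" for W
  proof -
    obtain v i where vi: "v \<in> {\<one>\<^bsub>G Mod N\<^esub>, b \<otimes>\<^bsub>G Mod N\<^esub> b}" "i \<in> {1..t}"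
      "W = v \<otimes>\<^bsub>G Mod N\<^esub> proj (y i)"
      using W unfolding set_mult_def[of "G Mod N"] by blast
    have yi: "y i \<in> carrier G" using vi(2) tr yc by auto
    have "y i \<in> P i" using Py[OF vi(2)] rcos_self[OF yi subgroup_N] by simp
    moreover have "P i \<subseteq> S" using Pi[OF vi(2)] by (auto elim: partsD)
    ultimately have yS: "y i \<in> S" by blast
    obtain u where u: "u \<in> {\<one>, c \<otimes> c}" "v = proj u"
      using vi(1) proj_one proj_mult[OF c(1) c(1)] c(2) by (metis insert_iff singletonD)
    have uc: "u \<in> carrier G" using u c by auto
    have "W = proj (u \<otimes> y i)" using vi(3) u(2) proj_mult[OF uc yi] by simp
    moreover have "u \<otimes> y i \<in> carrier G - restricted_sumset G S A B"
      unfolding unrep_S[OF ps c] using u yS unfolding set_mult_def by blast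
    ultimately show ?thesis using unrep_notin_signed_sumset[OF ps c] by simp
  qed
  thus ?thesis using tr yc inj Deq Py doubles_S[OF ps c] exc_eq
    by (intro exI[of _ r] exI[of _ y]) auto
qed

end

section \<open>Assembly of the theorem\<close>

theorem theorem23:
  fixes G :: "('a, 'b) monoid_scheme" (structure)
    and A B S :: "'a set"
    and P :: "nat \<Rightarrow> 'a set" and t :: nat
  assumes "comm_group G" and "finite (carrier G)"
    and "A \<subseteq> carrier G" and "B \<subseteq> carrier G" and "S \<subseteq> carrier G"
    and "A \<noteq> {}" and "B \<noteq> {}" and "S \<noteq> {}"
    and "card A + card B = order G + L_max G S"
    and "\<one> \<in> A \<inter> B \<inter> S"
    and "\<one> \<in> exceptions G S A B"
    and "int (card (restricted_sumset G S A B)) = int (order G) - 2 * int (card S)"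
    \<comment> \<open>\<open>P 1, \<dots>, P t\<close> is an arbitrary numbering of the parts of the decomposition of \<open>S\<close>\<close>
    and "bij_betw P {1..t} (decomposition_mod_doubles G S)"
  shows
    "(\<forall>i\<in>{1..t}. real (card (P i)) = real (L_max G S) / real (L_grp G) \<and>
        int (card (restricted_sumset G (P i) A B)) = int (order G) - 2 * int (card (P i))) \<and>
     exceptions G S A B = carrier G - restricted_sumset G S A B \<and>
     carrier G - restricted_sumset G S A B =
       (\<Union>i\<in>{1..t}. carrier G - restricted_sumset G (P i) A B) \<and>
     disjoint_family_on (\<lambda>i. carrier G - restricted_sumset G (P i) A B) {1..t} \<and>
     (\<one> \<in> P 1 \<longrightarrow>
       subgroup (P 1) G \<and>
       (let \<Gamma> = G Mod P 1; \<pi> = (\<lambda>g. P 1 #> g); A' = \<pi> ` A; B' = \<pi> ` B in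
         (\<exists>b x k l m. pair_structure \<Gamma> A' B' b x k l m) \<and>
         (\<forall>b x k l m. pair_structure \<Gamma> A' B' b x k l m \<longrightarrow>
           (let H = generate \<Gamma> {b \<otimes>\<^bsub>\<Gamma>\<^esub> b}; d = card H;
                Q = signed_part \<Gamma> H x k k l; R = signed_part \<Gamma> H x k l m in
             (real d + 1) / 2 > real (L_grp \<Gamma>) \<longrightarrow>
             (\<exists>r y. r \<ge> t \<and> y ` {1..r} \<subseteq> carrier G \<and>
               inj_on (\<lambda>i. P 1 #> y i) {1..r} \<and>
               {g \<in> carrier G. g \<otimes> g \<in> P 1} = (\<Union>i\<in>{1..r}. P 1 #> y i) \<and>
               (\<forall>i\<in>{1..t}. P i = P 1 #> y i) \<and>
               doubles G S \<subseteq> P 1 \<and>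
               (\<forall>c\<in>carrier G. \<pi> c = b \<longrightarrow> exceptions G S A B = {\<one>, c \<otimes> c} <#> S) \<and>
               ({\<one>\<^bsub>\<Gamma>\<^esub>, b \<otimes>\<^bsub>\<Gamma>\<^esub> b} <#>\<^bsub>\<Gamma>\<^esub> (\<pi> ` y ` {1..t})) \<inter> (Q <#>\<^bsub>\<Gamma>\<^esub> R) = {})))))"
proof -
  have fin: "finite (carrier G)" and AG: "A \<subseteq> carrier G" and BG: "B \<subseteq> carrier G"
    and P: "bij_betw P {1..t} (decomposition_mod_doubles G S)" using assms by auto
  interpret comm_group G by fact
  have rs: "restricted_sumset G T A B \<subseteq> carrier G" for T
    using AG BG by (auto simp: restricted_sumset_def subset_iff)
  have card_compl: "int (card (carrier G - restricted_sumset G T A B)) =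
      int (order G) - int (card (restricted_sumset G T A B))" for T
    using card_Diff_subset[OF finite_subset[OF rs fin] rs] card_mono[OF fin rs]
    by (simp add: order_def of_nat_diff)
  interpret extremal_pair G A B S
  proof
    show "\<one> \<notin> restricted_sumset G S A B" using assms(11) by (auto simp: exceptions_def)
    show "card (carrier G - restricted_sumset G S A B) = 2 * card S"
      using card_compl[of S] assms(12) by linarith
  qed (use assms in auto)
  have Pi: "P i \<in> parts" if "i \<in> {1..t}" for i using P that by (auto simp: bij_betw_def)
  have Pinj: "inj_on P {1..t}" and Pimg: "P ` {1..t} = parts" using P by (auto simp: bij_betw_def)
  have card_P: "real (card (P i)) = real (L_max G S) / real (L_grp G)" if i: "i \<in> {1..t}" for i
    using card_part[OF Pi[OF i], symmetric] L_grp_pos[OF fin] by simp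
  have card_rs: "int (card (restricted_sumset G (P i) A B)) = int (order G) - 2 * int (card (P i))"
    if i: "i \<in> {1..t}" for i
    using card_compl[of "P i"] card_unrep_part[OF Pi[OF i]] by linarith
  have exc: "exceptions G S A B = carrier G - restricted_sumset G S A B"
    unfolding exceptions_def set_mult_eq_carrier ..
  have Un: "carrier G - restricted_sumset G S A B =
      (\<Union>i\<in>{1..t}. carrier G - restricted_sumset G (P i) A B)"
    unfolding unrep_eq_Union_parts Pimg[symmetric] by blast
  have disj: "disjoint_family_on (\<lambda>i. carrier G - restricted_sumset G (P i) A B) {1..t}"
    unfolding disjoint_family_on_def
  proof (intro ballI impI)
    fix i j assume ij: "i \<in> {1..t}" "j \<in> {1..t}" "i \<noteq> j"
    hence "P i \<noteq> P j" using inj_onD[OF Pinj] by blast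
    thus "(carrier G - restricted_sumset G (P i) A B) \<inter> (carrier G - restricted_sumset G (P j) A B) = {}"
      using unrep_parts_eqI[OF Pi[OF ij(1)] Pi[OF ij(2)]] by blast
  qed
  have quotient: "subgroup (P 1) G \<and>
       (let \<Gamma> = G Mod P 1; \<pi> = (\<lambda>g. P 1 #> g); A' = \<pi> ` A; B' = \<pi> ` B in
         (\<exists>b x k l m. pair_structure \<Gamma> A' B' b x k l m) \<and>
         (\<forall>b x k l m. pair_structure \<Gamma> A' B' b x k l m \<longrightarrow>
           (let H = generate \<Gamma> {b \<otimes>\<^bsub>\<Gamma>\<^esub> b}; d = card H;
                Q = signed_part \<Gamma> H x k k l; R = signed_part \<Gamma> H x k l m in
             (real d + 1) / 2 > real (L_grp \<Gamma>) \<longrightarrow>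
             (\<exists>r y. r \<ge> t \<and> y ` {1..r} \<subseteq> carrier G \<and>
               inj_on (\<lambda>i. P 1 #> y i) {1..r} \<and>
               {g \<in> carrier G. g \<otimes> g \<in> P 1} = (\<Union>i\<in>{1..r}. P 1 #> y i) \<and>
               (\<forall>i\<in>{1..t}. P i = P 1 #> y i) \<and>
               doubles G S \<subseteq> P 1 \<and>
               (\<forall>c\<in>carrier G. \<pi> c = b \<longrightarrow> exceptions G S A B = {\<one>, c \<otimes> c} <#> S) \<and>
               ({\<one>\<^bsub>\<Gamma>\<^esub>, b \<otimes>\<^bsub>\<Gamma>\<^esub> b} <#>\<^bsub>\<Gamma>\<^esub> (\<pi> ` y ` {1..t})) \<inter> (Q <#>\<^bsub>\<Gamma>\<^esub> R) = {}))))"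
    if one: "\<one> \<in> P 1"
  proof -
    \<comment> \<open>\<open>P\<close> is arbitrary outside 1, ..., t, so t >= 1 is needed for
      \<open>P 1\<close> to be a part; it holds because 0 is unrepresented for some part.\<close>
    have "\<one> \<in> (\<Union>T\<in>parts. unrep T)"
      unfolding unrep_eq_Union_parts[symmetric] using one_unrep by simp
    hence "parts \<noteq> {}" by (rule UN_E) blast
    hence "t \<noteq> 0" using Pimg by (intro notI) simp
    hence "1 \<in> {1..t}" by simp
    hence "P 1 \<in> parts" by (rule Pi)
    then interpret extremal_quotient G A B S "P 1" using one by unfold_locales
    show ?thesis unfolding Let_def using subgroup_N ex_quot_pair_structure ex_coset_numbering[OF P] exc by auto
  qed
  show ?thesis using card_P card_rs exc Un disj quotient by blast
qed

end
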